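(* Let $X\in\mathbb{R}^{n\times K}$ be a snapshot matrix with largest singular value $\sigma_1$, and let $V_r$ be the left factor of its exact rank-$r$ truncated SVD. Let $\tilde V_r,\tilde\Sigma_r,\tilde W_r$ be approximate rank-$r$ SVD factors from a streaming SVD giving the approximation $\tilde X$ of $X$, with left singular vector error $\tau_v=\|V_r-\tilde V_r\|_F$. Assume the time-derivative data are computed via finite differences, $\dot X=X\Delta_K$. Suppose $\|X-\tilde X\|_2\le\varepsilon$, and that $\Gamma=\mathrm{diag}(\gamma_1,\dots,\gamma_d)$ with $\gamma_j>0$ for all $j$, and let $\sqrt{\gamma_{\min}}=\min_j\sqrt{\gamma_j}$. Let $\bar D,\bar R$ (exact) and $\tilde D,\tilde R$ (streaming) be the data matrices of the projection paradigms (iSVD-Project-LS/RLS), with data matrix perturbations $E_D$ and $E_R$, as defined in the context. Then $$\|E_D\|_2\le\frac{\beta_1}{\sqrt{\min\{n,K\}}}\,\tau_v,\qquad \|E_R\|_F\le\sigma_1\|\Delta_K\|_2\,\tau_v,$$ and the operator error between the batch solution $O=\bar D^\dagger\bar R$ and the streaming solution $\tilde O=\tilde D^\dagger\tilde R$ satisfies $$\|O-\tilde O\|_F\le\frac{\sigma_1\|\Delta_K\|_2}{\sqrt{\gamma_{\min}}}\,\tau_v\Bigl(1+\frac{\alpha\beta_1}{\sqrt{\gamma_{\min}}}\Bigr),$$ where $\beta_1=2\,(\sigma_1^4+\sigma_1^2+\eta^2+K)^{1/2}\sqrt{\min\{n,K\}}$ with $\eta=\|U\|_2$, and $\alpha=\sqrt2$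 if $K\neq d$, $\alpha=1$ if $K=d$.
   Context: Notation: $\|\cdot\|_2$ is the spectral norm, $\|\cdot\|_F$ the Frobenius norm, $^\dagger$ the Moore–Penrose pseudoinverse, $\otimes$ the Kronecker product, and for $A=[a_1,\dots,a_K]$, $A\odot A=[a_1\otimes a_1,\dots,a_K\otimes a_K]$ is the Khatri–Rao (column-wise Kronecker) product. All matrices are real; $\mathbf 1_K\in\mathbb{R}^K$ is the all-ones vector. Setting: $n,K,m$ are positive integers, $1\le r\le\min\{n,K\}$, $d=r+r^2+m+1$. $X\in\mathbb{R}^{n\times K}$ is the snapshot matrix, $U\in\mathbb{R}^{m\times K}$ the input matrix, $\Delta_K\in\mathbb{R}^{K\times K}$ a finite difference matrix and $\dot X=X\Delta_K$ the time-derivative data. Exact SVD: $X=V\Sigma W^\top$ with singular values $\sigma_1\ge\sigma_2\ge\dots\ge0$. $V_r\in\mathbb{R}^{n\times r}$ and $W_r\in\mathbb{R}^{K\times r}$ consist of the first $r$ left and right singular vectors (orthonormal columns), and $\Sigma_r=\mathrm{diag}(\sigma_1,\dots,\sigma_r)$. Streaming (approximate) SVD: $\tilde X=\tilde V\tilde\Sigma\tilde W^\top$ is an SVD (orthonormal columns in $\tilde V,\tilde W$; $\tilde\Sigma$ diagonal with nonnegative nonincreasing entries $\tilde\sigma_j$) approximating $X$, and $\tilde V_r\in\mathbb{R}^{n\times r}$, $\tilde\Sigma_r=\mathrm{diag}(\tilde\sigma_1,\dots,\tilde\sigma_r)$, $\tilde W_r\in\mathbb{R}^{K\times r}$ are its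 leading rank-$r$ factors. Data matrices of the projection paradigms (data are projected onto the basis given by the left singular vectors): $$D=[(V_r^\top X)^\top,\ (V_r^\top X\odot V_r^\top X)^\top,\ U^\top,\ \mathbf 1_K]\in\mathbb{R}^{K\times d},\qquad R=(V_r^\top\dot X)^\top\in\mathbb{R}^{K\times r},$$ $$\bar D=\begin{bmatrix}D\\ \Gamma^{1/2}\end{bmatrix},\qquad \bar R=\begin{bmatrix}R\\ 0_{d\times r}\end{bmatrix}.$$ The streaming matrices $\tilde D,\tilde R$ are obtained from $\bar D,\bar R$ by replacing $V_r$ with $\tilde V_r$ everywhere (with the same $X,\dot X,U,\Gamma$). The perturbations $E_D\in\mathbb{R}^{K\times d}$, $E_R\in\mathbb{R}^{K\times r}$ are defined by $\tilde D=\bar D+\begin{bmatrix}E_D\\0_{d\times d}\end{bmatrix}$ and $\tilde R=\bar R+\begin{bmatrix}E_R\\0_{d\times r}\end{bmatrix}$. *)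

theory Defs
  imports Complex_Main "Jordan_Normal_Form.Matrix"
begin

definition euclid_norm :: "real vec \<Rightarrow> real" where
  "euclid_norm x = sqrt (x \<bullet> x)"

text \<open>Using the closed unit ball rather than the unit sphere keeps the supremum
  over a nonempty set also when the matrix has no columns.\<close>

definition spectral_norm :: "real mat \<Rightarrow> real" where
  "spectral_norm A =
    (SUP x\<in>{x \<in> carrier_vec (dim_col A). euclid_norm x \<le> 1}. euclid_norm (A *\<^sub>v x))"

definition frobenius_norm :: "real mat \<Rightarrow> real" where
  "frobenius_norm A = sqrt (\<Sum>i<dim_row A. \<Sum>j<dim_col A. (A $$ (i,j))\<^sup>2)"

definition penrose_inverse :: "real mat \<Rightarrow> real mat \<Rightarrow> bool" where
  "penrose_inverse A B \<longleftrightarrow>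
     B \<in> carrier_mat (dim_col A) (dim_row A) \<and>
     A * B * A = A \<and> B * A * B = B \<and>
     transpose_mat (A * B) = A * B \<and> transpose_mat (B * A) = B * A"

definition pseudoinverse :: "real mat \<Rightarrow> real mat" where
  "pseudoinverse A = (THE B. penrose_inverse A B)"

definition kron_vec :: "real vec \<Rightarrow> real vec \<Rightarrow> real vec" where
  "kron_vec a b =
     vec (dim_vec a * dim_vec b) (\<lambda>i. a $ (i div dim_vec b) * b $ (i mod dim_vec b))"

definition khatri_rao :: "real mat \<Rightarrow> real mat \<Rightarrow> real mat" where
  "khatri_rao A B =
     mat_of_cols (dim_row A * dim_row B)
       (map (\<lambda>k. kron_vec (col A k) (col B k)) [0..<dim_col A])"

definition append_cols :: "real mat \<Rightarrow> real mat \<Rightarrow> real mat" (infixr \<open>@\<^sub>c\<close> 65) where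
  "A @\<^sub>c B = four_block_mat A B (0\<^sub>m 0 (dim_col A)) (0\<^sub>m 0 (dim_col B))"

text \<open>The inner dimensions \<open>dim_col V\<close> and \<open>dim_col W\<close> are left free, so that both the
  full SVD (square orthogonal factors, rectangular \<open>S\<close>) and the economy-size SVD are covered.
  The singular values are the diagonal entries of \<open>S\<close>, with indices starting at 0.\<close>

definition is_svd :: "real mat \<Rightarrow> real mat \<Rightarrow> real mat \<Rightarrow> real mat \<Rightarrow> bool" where
  "is_svd A V S W \<longleftrightarrow>
     dim_row V = dim_row A \<and> dim_row W = dim_col A \<and>
     S \<in> carrier_mat (dim_col V) (dim_col W) \<and>
     transpose_mat V * V = 1\<^sub>m (dim_col V) \<and> transpose_mat W * W = 1\<^sub>m (dim_col W) \<and>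
     diagonal_mat S \<and>
     (\<forall>j < min (dim_col V) (dim_col W). 0 \<le> S $$ (j,j)) \<and>
     (\<forall>i j. i \<le> j \<longrightarrow> j < min (dim_col V) (dim_col W) \<longrightarrow> S $$ (j,j) \<le> S $$ (i,i)) \<and>
     A = V * S * transpose_mat W"

definition leading_cols :: "nat \<Rightarrow> real mat \<Rightarrow> real mat" where
  "leading_cols r A = mat (dim_row A) r (\<lambda>(i,j). A $$ (i,j))"

definition leading_svd_factors ::
  "nat \<Rightarrow> real mat \<Rightarrow> real mat \<Rightarrow> real mat \<Rightarrow> real mat \<Rightarrow> real mat \<Rightarrow> real mat \<Rightarrow> bool" where
  "leading_svd_factors r V S W Vr Sr Wr \<longleftrightarrow>
     r \<le> dim_col V \<and> r \<le> dim_col W \<and>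
     Vr = leading_cols r V \<and> Sr = mat_diag r (\<lambda>j. S $$ (j,j)) \<and> Wr = leading_cols r W"

definition projected_data :: "real mat \<Rightarrow> real mat \<Rightarrow> real mat \<Rightarrow> real mat" where
  "projected_data V X U =
     (let Z = transpose_mat V * X in
      transpose_mat Z @\<^sub>c transpose_mat (khatri_rao Z Z) @\<^sub>c transpose_mat U
        @\<^sub>c mat (dim_col X) 1 (\<lambda>_. 1))"

definition projected_rhs :: "real mat \<Rightarrow> real mat \<Rightarrow> real mat" where
  "projected_rhs V Xdot = transpose_mat (transpose_mat V * Xdot)"

text \<open>For a diagonal matrix with nonnegative diagonal entries, this is its principal
  square root.\<close>

definition diag_sqrt :: "real mat \<Rightarrow> real mat" where
  "diag_sqrt G = mat_diag (dim_row G) (\<lambda>j. sqrt (G $$ (j,j)))"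

definition stacked_data :: "real mat \<Rightarrow> real mat \<Rightarrow> real mat \<Rightarrow> real mat \<Rightarrow> real mat" where
  "stacked_data V X U G = projected_data V X U @\<^sub>r diag_sqrt G"

definition stacked_rhs :: "real mat \<Rightarrow> real mat \<Rightarrow> nat \<Rightarrow> real mat" where
  "stacked_rhs V Xdot d = projected_rhs V Xdot @\<^sub>r 0\<^sub>m d (dim_col V)"

end

theory Submission
  imports Defs "HOL-Analysis.L2_Norm" "Jordan_Normal_Form.Determinant"
begin

text \<open>Stacking \<open>\<Gamma>\<^sup>1\<^sup>/\<^sup>2\<close> under the data matrix makes the columns independent, so the pseudoinverse is given by
  the normal equations and each column \<open>v\<close> of the operator is the ridge solution
  \<open>(D\<^sup>T D + \<Gamma>)\<^sup>-\<^sup>1 D\<^sup>T b\<close> for the corresponding column \<open>b\<close> of \<open>R\<close>. The estimates never use that inverse: a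
  solution is characterised by testing against all vectors, and every estimate is an energy estimate
  obtained from a suitable test vector.

  With \<open>u = b - D v\<close>, the pair \<open>(u, v)\<close> satisfies \<open>\<parallel>u\<parallel>\<^sup>2 + \<parallel>\<Gamma>\<^sup>1\<^sup>/\<^sup>2 v\<parallel>\<^sup>2 = b \<bullet> u\<close>, hence \<open>\<parallel>v\<parallel> \<le> \<parallel>b\<parallel> / sqrt \<gamma>\<close>, where
  \<open>\<gamma>\<close> is the smallest regularisation parameter (lemma \<open>regularised_solution_energy\<close>). For two data matrices
  differing by \<open>E\<close>, the skew-symmetric coupling of \<open>u\<close> and \<open>v\<close> drops out of the same computation for the
  difference of the two pairs, leaving \<open>\<parallel>v' - v\<parallel> \<le> \<parallel>E\<parallel> \<parallel>b\<parallel> / \<gamma>\<close> (lemma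
  \<open>regularised_solution_perturbation\<close>). The constant \<open>1\<close> obtained here is at most \<open>\<alpha>\<close> for either value of
  \<open>\<alpha>\<close>. For \<open>\<alpha> = 1\<close> a general theorem of Wedin's type would not suffice: it has
  the constant \<open>sqrt 2\<close> for matrices that are not square, and the stacked matrix never is. Summing over
  columns, the operator error is at most
  \<open>\<parallel>E\<^sub>R\<parallel>\<^sub>F / sqrt \<gamma> + \<parallel>E\<^sub>D\<parallel>\<^sub>2 \<parallel>R\<parallel>\<^sub>F / \<gamma>\<close> (lemma \<open>frobenius_norm_pseudoinverse_perturbation\<close>).

  It remains to bound the perturbations of the data. Since \<open>\<parallel>X\<parallel>\<^sub>2 \<le> \<sigma>\<^sub>1\<close>, the projected snapshots
  \<open>V\<^sub>r\<^sup>T X\<close> change by at most \<open>\<sigma>\<^sub>1 \<tau>\<^sub>v\<close>. The quadratic block is bilinear in them, and the Khatri--Rao product is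
  submultiplicative for the spectral norm (lemma \<open>spectral_norm_khatri_rao\<close>), so it changes by at most
  \<open>2 \<sigma>\<^sub>1\<^sup>2 \<tau>\<^sub>v\<close>; the blocks of inputs and ones do not change. Together
  \<open>\<parallel>E\<^sub>D\<parallel>\<^sub>2\<^sup>2 \<le> (\<sigma>\<^sub>1\<^sup>2 + 4 \<sigma>\<^sub>1\<^sup>4) \<tau>\<^sub>v\<^sup>2\<close>. The right-hand side is linear in the basis, which gives the bound for
  \<open>E\<^sub>R\<close> and, as \<open>V\<^sub>r\<close> has \<open>r \<le> min n K\<close> orthonormal columns, the bound
  \<open>\<parallel>R\<parallel>\<^sub>F \<le> sqrt (min n K) \<sigma>\<^sub>1 \<parallel>\<Delta>\<parallel>\<^sub>2\<close>.\<close>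

section \<open>Two inequalities for real numbers\<close>

text \<open>The Cauchy--Schwarz inequality in the plane, used to combine bounds on two blocks into a bound
  on the norm of the pair.\<close>

lemma mult_add_mult_le_sqrt:
  "a * x + b * y \<le> sqrt (a\<^sup>2 + b\<^sup>2) * sqrt (x\<^sup>2 + y\<^sup>2)"
proof -
  have "(a * x + b * y)\<^sup>2 \<le> (a\<^sup>2 + b\<^sup>2) * (x\<^sup>2 + y\<^sup>2)"
    using zero_le_power2 [of "a * y - b * x"] by (simp add: power2_eq_square algebra_simps)
  then show ?thesis by (simp add: real_le_rsqrt flip: real_sqrt_mult)
qed

text \<open>Energy estimates bound the square of a quantity by a multiple of that quantity; this cancels one
  factor without a separate treatment of the value \<open>0\<close>.\<close>

lemma le_of_mult_self_le:
  fixes x c :: real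
  assumes "x * x \<le> x * c" "0 \<le> c"
  shows "x \<le> c"
proof (cases "0 < x")
  case True
  then show ?thesis using assms(1) by simp
qed (use assms(2) in linarith)

section \<open>Euclidean, Frobenius and spectral norms\<close>

lemma euclid_norm_eq_L2_set: "euclid_norm x = L2_set (\<lambda>i. x $ i) {0..<dim_vec x}"
  unfolding euclid_norm_def L2_set_def scalar_prod_def by (simp add: power2_eq_square)

lemma euclid_norm_nonneg [simp]: "0 \<le> euclid_norm x"
  unfolding euclid_norm_eq_L2_set by simp

lemma scalar_prod_self: "x \<bullet> x = (euclid_norm x)\<^sup>2"
  unfolding euclid_norm_def scalar_prod_def
  by (simp add: sum_nonneg)

lemma euclid_norm_zero [simp]: "euclid_norm (0\<^sub>v n) = 0"
  unfolding euclid_norm_def by simp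

lemma euclid_norm_eq_0_iff: "x \<in> carrier_vec n \<Longrightarrow> euclid_norm x = 0 \<longleftrightarrow> x = 0\<^sub>v n"
  unfolding euclid_norm_eq_L2_set by (auto simp: L2_set_eq_0_iff)

lemma euclid_norm_smult: "euclid_norm (c \<cdot>\<^sub>v x) = \<bar>c\<bar> * euclid_norm x"
  unfolding euclid_norm_eq_L2_set L2_set_def
  by (simp add: power_mult_distrib real_sqrt_mult flip: sum_distrib_left)

lemma Cauchy_Schwarz:
  assumes "x \<in> carrier_vec n" "y \<in> carrier_vec n"
  shows "\<bar>x \<bullet> y\<bar> \<le> euclid_norm x * euclid_norm y"
proof -
  have "\<bar>x \<bullet> y\<bar> \<le> (\<Sum>i\<in>{0..<n}. \<bar>x $ i\<bar> * \<bar>y $ i\<bar>)"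
    using assms unfolding scalar_prod_def by (auto simp flip: abs_mult intro!: sum_abs)
  also have "\<dots> \<le> L2_set (\<lambda>i. x $ i) {0..<n} * L2_set (\<lambda>i. y $ i) {0..<n}"
    by (rule L2_set_mult_ineq)
  finally show ?thesis using assms unfolding euclid_norm_eq_L2_set by simp
qed

lemma euclid_norm_append_square:
  "(euclid_norm (x @\<^sub>v y))\<^sup>2 = (euclid_norm x)\<^sup>2 + (euclid_norm y)\<^sup>2"
  unfolding scalar_prod_self [symmetric]
  by (rule scalar_prod_append) (auto intro: carrier_vecI)

lemma euclid_norm_triangle:
  assumes "x \<in> carrier_vec n" "y \<in> carrier_vec n"
  shows "euclid_norm (x + y) \<le> euclid_norm x + euclid_norm y"
  using assms L2_set_triangle_ineq [of "\<lambda>i. x $ i" "\<lambda>i. y $ i" "{0..<n}"]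
  unfolding euclid_norm_eq_L2_set by (simp cong: L2_set_cong_simp)

lemma frobenius_norm_nonneg [simp]: "0 \<le> frobenius_norm A"
  unfolding frobenius_norm_def by (simp add: sum_nonneg)

lemma frobenius_norm_eq_L2_set_entries:
  "frobenius_norm A = L2_set (\<lambda>ij. A $$ ij) ({..<dim_row A} \<times> {..<dim_col A})"
  unfolding frobenius_norm_def L2_set_def by (simp add: sum.cartesian_product)

lemma frobenius_norm_eq_L2_set_cols:
  "frobenius_norm A = L2_set (\<lambda>j. euclid_norm (col A j)) {..<dim_col A}"
proof -
  have "(euclid_norm (col A j))\<^sup>2 = (\<Sum>i<dim_row A. (A $$ (i,j))\<^sup>2)" if "j < dim_col A" for j
    using that unfolding scalar_prod_self [symmetric] scalar_prod_def
    by (auto simp: power2_eq_square lessThan_atLeast0)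
  then show ?thesis
    unfolding frobenius_norm_def L2_set_def by (simp add: sum.swap [of _ "{..<dim_col A}"])
qed

lemma frobenius_norm_transpose: "frobenius_norm (transpose_mat A) = frobenius_norm A"
  unfolding frobenius_norm_def by (simp add: sum.swap [of _ "{..<dim_row A}"])

lemma frobenius_norm_triangle:
  assumes "A \<in> carrier_mat m n" "B \<in> carrier_mat m n"
  shows "frobenius_norm (A + B) \<le> frobenius_norm A + frobenius_norm B"
proof -
  have "frobenius_norm (A + B) = L2_set (\<lambda>ij. A $$ ij + B $$ ij) ({..<m} \<times> {..<n})"
    using assms unfolding frobenius_norm_eq_L2_set_entries by (auto intro!: L2_set_cong)
  with assms show ?thesis
    using L2_set_triangle_ineq [of "\<lambda>ij. A $$ ij" "\<lambda>ij. B $$ ij" "{..<m} \<times> {..<n}"]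
    by (auto simp: frobenius_norm_eq_L2_set_entries)
qed

lemma frobenius_norm_minus_commute:
  assumes "A \<in> carrier_mat m n" "B \<in> carrier_mat m n"
  shows "frobenius_norm (A - B) = frobenius_norm (B - A)"
  using assms unfolding frobenius_norm_def by (simp add: power2_commute)

text \<open>The Frobenius norm is the Euclidean norm of the vector of column norms, so a uniform bound for
  the columns is inherited by the matrix. All Frobenius bounds for operators below reduce in this way
  to statements about single vectors.\<close>

lemma frobenius_norm_le_colwise:
  assumes "dim_col A = dim_col B" "0 \<le> c"
    and "\<And>j. j < dim_col B \<Longrightarrow> euclid_norm (col A j) \<le> c * euclid_norm (col B j)"
  shows "frobenius_norm A \<le> c * frobenius_norm B"
proof -
  have "frobenius_norm A \<le> L2_set (\<lambda>j. c * euclid_norm (col B j)) {..<dim_col B}"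
    unfolding frobenius_norm_eq_L2_set_cols using assms by (auto intro!: L2_set_mono)
  also have "\<dots> = c * frobenius_norm B"
    unfolding frobenius_norm_eq_L2_set_cols using assms(2) by (simp add: L2_set_right_distrib)
  finally show ?thesis .
qed

lemma euclid_norm_mult_le_frobenius:
  assumes "A \<in> carrier_mat m n" "x \<in> carrier_vec n"
  shows "euclid_norm (A *\<^sub>v x) \<le> frobenius_norm A * euclid_norm x"
proof -
  have "euclid_norm (A *\<^sub>v x) = L2_set (\<lambda>i. row A i \<bullet> x) {..<m}"
    using assms unfolding euclid_norm_eq_L2_set by (auto intro!: L2_set_cong)
  also have "\<dots> = L2_set (\<lambda>i. \<bar>row A i \<bullet> x\<bar>) {..<m}"
    unfolding L2_set_def by simp
  also have "\<dots> \<le> L2_set (\<lambda>i. euclid_norm (row A i) * euclid_norm x) {..<m}"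
    using assms by (intro L2_set_mono Cauchy_Schwarz [of _ n]) auto
  also have "\<dots> = L2_set (\<lambda>i. euclid_norm (row A i)) {..<m} * euclid_norm x"
    by (simp add: L2_set_left_distrib)
  also have "L2_set (\<lambda>i. euclid_norm (row A i)) {..<m} = frobenius_norm A"
    using assms frobenius_norm_eq_L2_set_cols [of "transpose_mat A"]
    by (auto simp: frobenius_norm_transpose intro!: L2_set_cong)
  finally show ?thesis .
qed

text \<open>Every fact about the spectral norm needs the defining supremum to be over a bounded set; the
  Frobenius norm provides the bound.\<close>

lemma bdd_above_spectral_norm:
  "bdd_above ((\<lambda>x. euclid_norm (A *\<^sub>v x)) ` {x \<in> carrier_vec (dim_col A). euclid_norm x \<le> 1})"
proof (rule bdd_aboveI2)
  fix x assume x: "x \<in> {x \<in> carrier_vec (dim_col A). euclid_norm x \<le> 1}"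
  then have "euclid_norm (A *\<^sub>v x) \<le> frobenius_norm A * euclid_norm x"
    by (intro euclid_norm_mult_le_frobenius [of _ "dim_row A"]) auto
  also have "\<dots> \<le> frobenius_norm A * 1" using x by (intro mult_left_mono) auto
  finally show "euclid_norm (A *\<^sub>v x) \<le> frobenius_norm A" by simp
qed

lemma euclid_norm_mult_le_of_unit_ball:
  assumes "x \<in> carrier_vec (dim_col A)" "euclid_norm x \<le> 1"
  shows "euclid_norm (A *\<^sub>v x) \<le> spectral_norm A"
  unfolding spectral_norm_def using assms
  by (intro cSUP_upper bdd_above_spectral_norm) auto

lemma spectral_norm_nonneg [simp]: "0 \<le> spectral_norm A"
  using euclid_norm_mult_le_of_unit_ball [of "0\<^sub>v (dim_col A)" A]
    euclid_norm_nonneg [of "A *\<^sub>v 0\<^sub>v (dim_col A)"]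
  by (smt (verit) euclid_norm_zero zero_carrier_vec)

lemma euclid_norm_mult_le_spectral:
  assumes "A \<in> carrier_mat m n" "x \<in> carrier_vec n"
  shows "euclid_norm (A *\<^sub>v x) \<le> spectral_norm A * euclid_norm x"
proof (cases "euclid_norm x = 0")
  case True
  then have "euclid_norm (A *\<^sub>v x) \<le> 0"
    using euclid_norm_mult_le_frobenius [OF assms] by simp
  then show ?thesis using True by simp
next
  case False
  then have pos: "euclid_norm x > 0" using euclid_norm_nonneg [of x] by linarith
  let ?y = "(1 / euclid_norm x) \<cdot>\<^sub>v x"
  have "euclid_norm (A *\<^sub>v ?y) \<le> spectral_norm A"
    using assms pos by (intro euclid_norm_mult_le_of_unit_ball) (auto simp: euclid_norm_smult)
  moreover have "A *\<^sub>v ?y = (1 / euclid_norm x) \<cdot>\<^sub>v (A *\<^sub>v x)"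
    using assms by (intro mult_mat_vec) auto
  ultimately show ?thesis using pos by (simp add: euclid_norm_smult field_simps)
qed

lemma spectral_norm_leI:
  assumes "0 \<le> c" "dim_col A = n"
    and "\<And>x. x \<in> carrier_vec n \<Longrightarrow> euclid_norm (A *\<^sub>v x) \<le> c * euclid_norm x"
  shows "spectral_norm A \<le> c"
  unfolding spectral_norm_def
proof (rule cSUP_least)
  show "{x \<in> carrier_vec (dim_col A). euclid_norm x \<le> 1} \<noteq> {}"
    using zero_carrier_vec [of "dim_col A"] by fastforce
  fix x assume x: "x \<in> {x \<in> carrier_vec (dim_col A). euclid_norm x \<le> 1}"
  then have "euclid_norm (A *\<^sub>v x) \<le> c * euclid_norm x" using assms by auto
  also have "\<dots> \<le> c * 1" using x assms(1) by (intro mult_left_mono) auto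
  finally show "euclid_norm (A *\<^sub>v x) \<le> c" by simp
qed

lemma spectral_norm_le_frobenius: "spectral_norm A \<le> frobenius_norm A"
  by (rule spectral_norm_leI [OF _ refl])
    (auto intro: euclid_norm_mult_le_frobenius [of _ "dim_row A"])

lemma spectral_norm_zero [simp]: "spectral_norm (0\<^sub>m m n) = 0"
proof -
  have "spectral_norm (0\<^sub>m m n) \<le> 0"
    by (rule spectral_norm_leI [OF _ refl]) (auto simp: euclid_norm_eq_L2_set L2_set_def)
  then show ?thesis using spectral_norm_nonneg [of "0\<^sub>m m n"] by linarith
qed

lemma spectral_norm_triangle:
  assumes "A \<in> carrier_mat m n" "B \<in> carrier_mat m n"
  shows "spectral_norm (A + B) \<le> spectral_norm A + spectral_norm B"
proof (rule spectral_norm_leI)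
  fix x :: "real vec" assume x: "x \<in> carrier_vec n"
  have "euclid_norm ((A + B) *\<^sub>v x) \<le> euclid_norm (A *\<^sub>v x) + euclid_norm (B *\<^sub>v x)"
    using assms x by (auto simp: add_mult_distrib_mat_vec intro!: euclid_norm_triangle [of _ m])
  also have "\<dots> \<le> (spectral_norm A + spectral_norm B) * euclid_norm x"
    using euclid_norm_mult_le_spectral [OF assms(1) x] euclid_norm_mult_le_spectral [OF assms(2) x]
    by (simp add: distrib_right)
  finally show "euclid_norm ((A + B) *\<^sub>v x) \<le> (spectral_norm A + spectral_norm B) * euclid_norm x" .
qed (use assms in auto)

text \<open>Testing with \<open>z = A\<^sup>T y\<close> gives \<open>\<parallel>z\<parallel>\<^sup>2 = (A z) \<bullet> y \<le> \<parallel>A\<parallel> \<parallel>z\<parallel> \<parallel>y\<parallel>\<close>, and one factor \<open>\<parallel>z\<parallel>\<close> cancels.\<close>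

lemma spectral_norm_transpose_le: "spectral_norm (transpose_mat A) \<le> spectral_norm A"
proof (rule spectral_norm_leI)
  fix y :: "real vec" assume y: "y \<in> carrier_vec (dim_row A)"
  let ?z = "transpose_mat A *\<^sub>v y"
  have A: "A \<in> carrier_mat (dim_row A) (dim_col A)" by simp
  have z: "?z \<in> carrier_vec (dim_col A)" by (simp add: carrier_vecI)
  have "(euclid_norm ?z)\<^sup>2 = (A *\<^sub>v ?z) \<bullet> y"
    unfolding scalar_prod_self [symmetric] transpose_vec_mult_scalar [OF A z y]
    by (rule comm_scalar_prod [OF y mult_mat_vec_carrier [OF A z]])
  also have "\<dots> \<le> euclid_norm (A *\<^sub>v ?z) * euclid_norm y"
    using Cauchy_Schwarz [OF mult_mat_vec_carrier [OF A z] y] by linarith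
  also have "\<dots> \<le> (spectral_norm A * euclid_norm ?z) * euclid_norm y"
    by (intro mult_right_mono euclid_norm_mult_le_spectral [OF A z]) auto
  finally have "euclid_norm ?z * euclid_norm ?z
      \<le> (spectral_norm A * euclid_norm y) * euclid_norm ?z"
    by (simp add: power2_eq_square mult_ac)
  then show "euclid_norm ?z \<le> spectral_norm A * euclid_norm y"
    by (cases "euclid_norm ?z = 0") (auto simp: less_le)
qed auto

lemma spectral_norm_transpose [simp]: "spectral_norm (transpose_mat A) = spectral_norm A"
  using spectral_norm_transpose_le [of A] spectral_norm_transpose_le [of "transpose_mat A"] by simp

lemma frobenius_norm_mult_left:
  assumes "A \<in> carrier_mat m n" "B \<in> carrier_mat n k"
  shows "frobenius_norm (A * B) \<le> spectral_norm A * frobenius_norm B"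
  using assms
  by (intro frobenius_norm_le_colwise)
    (auto simp del: col_mult intro!: euclid_norm_mult_le_spectral)

lemma frobenius_norm_mult_right:
  assumes "A \<in> carrier_mat m n" "B \<in> carrier_mat n k"
  shows "frobenius_norm (A * B) \<le> frobenius_norm A * spectral_norm B"
  using frobenius_norm_mult_left [of "transpose_mat B" k n "transpose_mat A" m] assms
  by (simp add: frobenius_norm_transpose mult.commute flip: transpose_mult)

lemma spectral_norm_mult:
  assumes "A \<in> carrier_mat m n" "B \<in> carrier_mat n k"
  shows "spectral_norm (A * B) \<le> spectral_norm A * spectral_norm B"
proof (rule spectral_norm_leI)
  fix x :: "real vec" assume x: "x \<in> carrier_vec k"
  have "euclid_norm ((A * B) *\<^sub>v x) = euclid_norm (A *\<^sub>v (B *\<^sub>v x))"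
    using assms x by simp
  also have "\<dots> \<le> spectral_norm A * euclid_norm (B *\<^sub>v x)"
    using assms x by (intro euclid_norm_mult_le_spectral) auto
  also have "\<dots> \<le> spectral_norm A * (spectral_norm B * euclid_norm x)"
    using assms x by (intro mult_left_mono euclid_norm_mult_le_spectral) auto
  finally show "euclid_norm ((A * B) *\<^sub>v x) \<le> spectral_norm A * spectral_norm B * euclid_norm x"
    by (simp add: mult_ac)
qed (use assms in auto)

section \<open>Orthonormal columns and the singular value decomposition\<close>

lemma euclid_norm_mult_orthonormal:
  assumes "Q \<in> carrier_mat m n" "transpose_mat Q * Q = 1\<^sub>m n" "x \<in> carrier_vec n"
  shows "euclid_norm (Q *\<^sub>v x) = euclid_norm x"
proof -
  have "(Q *\<^sub>v x) \<bullet> (Q *\<^sub>v x) = (transpose_mat Q *\<^sub>v (Q *\<^sub>v x)) \<bullet> x"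
    using assms by (intro transpose_vec_mult_scalar [symmetric, of _ m n]) auto
  also have "transpose_mat Q *\<^sub>v (Q *\<^sub>v x) = x"
    using assms by (simp flip: assoc_mult_mat_vec)
  finally show ?thesis unfolding euclid_norm_def by simp
qed

lemma spectral_norm_orthonormal_le_1:
  assumes "Q \<in> carrier_mat m n" "transpose_mat Q * Q = 1\<^sub>m n"
  shows "spectral_norm Q \<le> 1"
  by (rule spectral_norm_leI) (use assms euclid_norm_mult_orthonormal in auto)

lemma spectral_norm_diagonal_le:
  assumes "S \<in> carrier_mat p q" "diagonal_mat S" "0 \<le> s"
    and "\<And>j. j < min p q \<Longrightarrow> \<bar>S $$ (j,j)\<bar> \<le> s"
  shows "spectral_norm S \<le> s"
proof (rule spectral_norm_leI)
  fix x :: "real vec" assume x: "x \<in> carrier_vec q"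
  have entry: "(S *\<^sub>v x) $ i = (if i < q then S $$ (i,i) * x $ i else 0)" if "i < p" for i
  proof -
    have "(S *\<^sub>v x) $ i = (\<Sum>j\<in>{0..<q}. S $$ (i,j) * x $ j)"
      using assms x that by (simp add: scalar_prod_def)
    also have "\<dots> = (\<Sum>j\<in>{0..<q}. if j = i then S $$ (i,i) * x $ i else 0)"
      using assms that unfolding diagonal_mat_def by (intro sum.cong) auto
    finally show ?thesis by simp
  qed
  have "(euclid_norm (S *\<^sub>v x))\<^sup>2 = (\<Sum>i\<in>{0..<p}. ((S *\<^sub>v x) $ i)\<^sup>2)"
    using assms by (simp add: euclid_norm_eq_L2_set L2_set_def sum_nonneg)
  also have "\<dots> = (\<Sum>i\<in>{0..<min p q}. (S $$ (i,i) * x $ i)\<^sup>2)"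
    by (intro sum.mono_neutral_cong_right) (auto simp: entry)
  also have "\<dots> \<le> (\<Sum>i\<in>{0..<min p q}. s\<^sup>2 * (x $ i)\<^sup>2)"
    using assms(3,4)
    by (intro sum_mono) (auto simp: power_mult_distrib abs_le_square_iff [symmetric] intro!: mult_right_mono)
  also have "\<dots> \<le> (\<Sum>i\<in>{0..<q}. s\<^sup>2 * (x $ i)\<^sup>2)"
    by (intro sum_mono2) auto
  also have "\<dots> = (s * euclid_norm x)\<^sup>2"
    using x by (simp add: euclid_norm_eq_L2_set L2_set_def sum_nonneg power_mult_distrib sum_distrib_left)
  finally show "euclid_norm (S *\<^sub>v x) \<le> s * euclid_norm x"
    by (rule power2_le_imp_le) (use assms in auto)
qed (use assms in auto)

text \<open>The two factors with orthonormal columns have norm at most \<open>1\<close>, and the norm of the diagonal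
  factor is governed by its largest entry, which comes first.\<close>

lemma spectral_norm_le_first_singular_value:
  assumes "is_svd A V S W" "0 < dim_col V" "0 < dim_col W"
  shows "spectral_norm A \<le> S $$ (0,0)"
proof -
  have dims: "dim_row V = dim_row A" "dim_row W = dim_col A"
    and S: "S \<in> carrier_mat (dim_col V) (dim_col W)" "diagonal_mat S"
    and orth: "transpose_mat V * V = 1\<^sub>m (dim_col V)" "transpose_mat W * W = 1\<^sub>m (dim_col W)"
    and nonneg: "\<forall>j < min (dim_col V) (dim_col W). 0 \<le> S $$ (j,j)"
    and decr: "\<forall>i j. i \<le> j \<longrightarrow> j < min (dim_col V) (dim_col W) \<longrightarrow> S $$ (j,j) \<le> S $$ (i,i)"
    and A: "A = V * S * transpose_mat W"
    using assms(1) unfolding is_svd_def by blast+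
  have V: "V \<in> carrier_mat (dim_row A) (dim_col V)" and W: "W \<in> carrier_mat (dim_col A) (dim_col W)"
    using dims by (auto intro: carrier_matI)
  have s0: "0 \<le> S $$ (0,0)" using nonneg assms(2,3) by simp
  have V1: "spectral_norm V \<le> 1" and W1: "spectral_norm W \<le> 1"
    using spectral_norm_orthonormal_le_1 [OF V orth(1)] spectral_norm_orthonormal_le_1 [OF W orth(2)] .
  have S0: "spectral_norm S \<le> S $$ (0,0)"
    using nonneg decr by (intro spectral_norm_diagonal_le [OF S s0]) auto
  have "spectral_norm A = spectral_norm (V * S * transpose_mat W)"
    by (rule arg_cong [OF A])
  also have "\<dots> \<le> spectral_norm (V * S) * spectral_norm (transpose_mat W)"
    by (rule spectral_norm_mult [OF mult_carrier_mat [OF V S(1)] transpose_carrier_mat [THEN iffD2, OF W]])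
  also have "\<dots> \<le> spectral_norm V * spectral_norm S * spectral_norm (transpose_mat W)"
    by (intro mult_right_mono spectral_norm_mult [OF V S(1)]) simp
  also have "\<dots> \<le> 1 * S $$ (0,0) * 1"
    using V1 W1 S0 s0 by (intro mult_mono) auto
  finally show ?thesis by simp
qed

lemma leading_cols_carrier [simp]: "leading_cols r A \<in> carrier_mat (dim_row A) r"
  unfolding leading_cols_def by simp

lemma leading_cols_orthonormal:
  assumes "transpose_mat Q * Q = 1\<^sub>m (dim_col Q)" "r \<le> dim_col Q"
  shows "transpose_mat (leading_cols r Q) * leading_cols r Q = 1\<^sub>m r"
proof (rule eq_matI)
  fix i j assume ij: "i < dim_row (1\<^sub>m r :: real mat)" "j < dim_col (1\<^sub>m r :: real mat)"
  have "col (leading_cols r Q) k = col Q k" if "k < r" for k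
    using that assms(2) unfolding leading_cols_def by (intro eq_vecI) auto
  then have "(transpose_mat (leading_cols r Q) * leading_cols r Q) $$ (i,j)
      = (transpose_mat Q * Q) $$ (i,j)"
    using ij assms(2) by (simp add: leading_cols_def)
  also have "\<dots> = 1\<^sub>m r $$ (i,j)" using ij assms by simp
  finally show "(transpose_mat (leading_cols r Q) * leading_cols r Q) $$ (i,j) = 1\<^sub>m r $$ (i,j)" .
qed (auto simp: leading_cols_def)

section \<open>The Khatri--Rao product\<close>

lemma dim_khatri_rao [simp]:
  "dim_row (khatri_rao A B) = dim_row A * dim_row B" "dim_col (khatri_rao A B) = dim_col A"
  unfolding khatri_rao_def by (simp_all add: mat_of_cols_def)

lemma khatri_rao_index:
  assumes "A \<in> carrier_mat p k" "B \<in> carrier_mat q k" "i < p * q" "l < k"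
  shows "khatri_rao A B $$ (i,l) = A $$ (i div q, l) * B $$ (i mod q, l)"
proof -
  have "i div q < p" "i mod q < q"
    using assms(3) by (auto simp: less_mult_imp_div_less intro!: mod_less_divisor Nat.gr0I)
  then show ?thesis using assms unfolding khatri_rao_def kron_vec_def
    by (auto simp: mat_of_cols_index)
qed

text \<open>The Khatri--Rao product is bilinear, so the difference of two products telescopes.\<close>

lemma khatri_rao_diff:
  assumes "A \<in> carrier_mat p k" "A' \<in> carrier_mat p k" "B \<in> carrier_mat q k" "B' \<in> carrier_mat q k"
  shows "khatri_rao A B - khatri_rao A' B' = khatri_rao A (B - B') + khatri_rao (A - A') B'"
proof (rule eq_matI)
  fix i l assume "i < dim_row (khatri_rao A (B - B') + khatri_rao (A - A') B')"
    and "l < dim_col (khatri_rao A (B - B') + khatri_rao (A - A') B')"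
  then have il: "i < p * q" "l < k"
    using assms by auto
  moreover have "i div q < p" "i mod q < q"
    using il by (auto simp: less_mult_imp_div_less intro!: mod_less_divisor Nat.gr0I)
  moreover have "B - B' \<in> carrier_mat q k" "A - A' \<in> carrier_mat p k" using assms by auto
  ultimately show "(khatri_rao A B - khatri_rao A' B') $$ (i,l)
      = (khatri_rao A (B - B') + khatri_rao (A - A') B') $$ (i,l)"
    using assms by (simp add: khatri_rao_index [of _ p k _ q] algebra_simps)
qed (use assms in auto)

lemma frobenius_norm_mat_diag: "frobenius_norm (mat_diag k f) = L2_set f {..<k}"
proof -
  have "(\<Sum>j<k. (mat_diag k f $$ (i,j))\<^sup>2) = (f i)\<^sup>2" if "i < k" for i
  proof -
    have "(\<Sum>j<k. (mat_diag k f $$ (i,j))\<^sup>2) = (\<Sum>j<k. if j = i then (f i)\<^sup>2 else 0)"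
      using that by (intro sum.cong) (auto simp: mat_diag_def)
    then show ?thesis using that by simp
  qed
  then show ?thesis unfolding frobenius_norm_def L2_set_def by (simp add: mat_diag_def)
qed

text \<open>Applied to \<open>x\<close>, the Khatri--Rao product stacks the rows of the \<open>p \<times> q\<close> matrix
  \<open>A diag(x) B\<^sup>T\<close> into one vector. The Euclidean norm of that vector is the Frobenius norm of the
  matrix, and \<open>\<parallel>diag(x)\<parallel>\<^sub>F = \<parallel>x\<parallel>\<close>. This avoids embedding the product as a column selection of the full
  Kronecker product.\<close>

lemma spectral_norm_khatri_rao:
  assumes A: "A \<in> carrier_mat p k" and B: "B \<in> carrier_mat q k"
  shows "spectral_norm (khatri_rao A B) \<le> spectral_norm A * spectral_norm B"
proof (rule spectral_norm_leI)
  have KR: "khatri_rao A B \<in> carrier_mat (p * q) k" using assms by auto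
  then show "dim_col (khatri_rao A B) = k" by (rule carrier_matD)
  fix x :: "real vec" assume x: "x \<in> carrier_vec k"
  define M where "M = A * (mat_diag k (\<lambda>l. x $ l) * transpose_mat B)"
  have M: "M \<in> carrier_mat p q" unfolding M_def
    by (intro mult_carrier_mat [of _ _ k] A) (use B in auto)
  have DB: "mat_diag k (\<lambda>l. x $ l) * transpose_mat B \<in> carrier_mat k q"
    by (rule mult_carrier_mat [of _ _ k]) (use B in auto)
  have Mij: "M $$ (a,b) = (\<Sum>l\<in>{0..<k}. A $$ (a,l) * B $$ (b,l) * x $ l)" if "a < p" "b < q" for a b
  proof -
    have "mat_diag k (\<lambda>l. x $ l) * transpose_mat B = mat k q (\<lambda>(l,b). x $ l * B $$ (b,l))"
      using B by (subst mat_diag_mult_left [of _ k q]) (auto intro!: eq_matI)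
    then show ?thesis using assms that unfolding M_def
      by (auto simp: scalar_prod_def intro!: sum.cong)
  qed
  have entry: "(khatri_rao A B *\<^sub>v x) $ (a * q + b) = M $$ (a,b)" if "a < p" "b < q" for a b
  proof -
    have "a * q + b < p * q"
    proof -
      have "a * q + b < (a + 1) * q" using that by simp
      also have "\<dots> \<le> p * q" using that by (intro mult_right_mono) auto
      finally show ?thesis .
    qed
    moreover have "(a * q + b) div q = a" "(a * q + b) mod q = b" using that by auto
    ultimately show ?thesis using A B x that
      by (auto simp: scalar_prod_def Mij khatri_rao_index [OF A B] intro!: sum.cong)
  qed
  have "(euclid_norm (khatri_rao A B *\<^sub>v x))\<^sup>2 = (\<Sum>i<p*q. ((khatri_rao A B *\<^sub>v x) $ i)\<^sup>2)"
    using A B by (simp add: euclid_norm_eq_L2_set L2_set_def sum_nonneg lessThan_atLeast0)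
  also have "\<dots> = (\<Sum>a<p. \<Sum>i\<in>{a * q..<a * q + q}. ((khatri_rao A B *\<^sub>v x) $ i)\<^sup>2)"
    by (rule sum.nat_group [symmetric])
  also have "\<dots> = (\<Sum>a<p. \<Sum>b<q. (M $$ (a,b))\<^sup>2)"
  proof (rule sum.cong [OF refl])
    fix a assume "a \<in> {..<p}"
    then show "(\<Sum>i\<in>{a * q..<a * q + q}. ((khatri_rao A B *\<^sub>v x) $ i)\<^sup>2) = (\<Sum>b<q. (M $$ (a,b))\<^sup>2)"
      using sum.shift_bounds_nat_ivl [of "\<lambda>i. ((khatri_rao A B *\<^sub>v x) $ i)\<^sup>2" 0 "a * q" q]
      by (auto simp: lessThan_atLeast0 entry [symmetric] add.commute intro!: sum.cong)
  qed
  also have "\<dots> = (frobenius_norm M)\<^sup>2"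
    using M by (simp add: frobenius_norm_def sum_nonneg)
  finally have "euclid_norm (khatri_rao A B *\<^sub>v x) = frobenius_norm M"
    by (simp add: power2_eq_iff_nonneg)
  also have "\<dots> \<le> spectral_norm A * frobenius_norm (mat_diag k (\<lambda>l. x $ l) * transpose_mat B)"
    unfolding M_def by (rule frobenius_norm_mult_left [OF A DB])
  also have "\<dots> \<le> spectral_norm A * (frobenius_norm (mat_diag k (\<lambda>l. x $ l)) * spectral_norm (transpose_mat B))"
    using B by (intro mult_left_mono frobenius_norm_mult_right [of _ k k]) auto
  also have "frobenius_norm (mat_diag k (\<lambda>l. x $ l)) = euclid_norm x"
    using x by (simp add: frobenius_norm_mat_diag euclid_norm_eq_L2_set lessThan_atLeast0)
  finally show "euclid_norm (khatri_rao A B *\<^sub>v x) \<le> spectral_norm A * spectral_norm B * euclid_norm x"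
    by (simp add: mult_ac)
qed auto

section \<open>Column blocks\<close>

lemma dim_append_cols [simp]:
  "dim_row (A @\<^sub>c B) = dim_row A" "dim_col (A @\<^sub>c B) = dim_col A + dim_col B"
  unfolding append_cols_def by simp_all

lemma append_cols_diff:
  assumes "A \<in> carrier_mat m n" "A' \<in> carrier_mat m n" "B \<in> carrier_mat m k" "B' \<in> carrier_mat m k"
  shows "(A @\<^sub>c B) - (A' @\<^sub>c B') = (A - A') @\<^sub>c (B - B')"
  using assms unfolding append_cols_def by (intro eq_matI) auto

lemma mult_append_cols_vec:
  assumes "A \<in> carrier_mat m n" "B \<in> carrier_mat m k" "x \<in> carrier_vec n" "y \<in> carrier_vec k"
  shows "(A @\<^sub>c B) *\<^sub>v (x @\<^sub>v y) = A *\<^sub>v x + B *\<^sub>v y"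
proof (rule eq_vecI)
  fix i assume "i < dim_vec (A *\<^sub>v x + B *\<^sub>v y)"
  then have i: "i < m" using assms by simp
  have "row (A @\<^sub>c B) i = row A i @\<^sub>v row B i"
    using assms i unfolding append_cols_def by (intro eq_vecI) auto
  then show "((A @\<^sub>c B) *\<^sub>v (x @\<^sub>v y)) $ i = (A *\<^sub>v x + B *\<^sub>v y) $ i"
    using assms i
    by (auto simp: scalar_prod_append [of _ n _ k])
qed (use assms in auto)

lemma spectral_norm_append_cols_square:
  assumes A: "A \<in> carrier_mat m n" and B: "B \<in> carrier_mat m k"
  shows "(spectral_norm (A @\<^sub>c B))\<^sup>2 \<le> (spectral_norm A)\<^sup>2 + (spectral_norm B)\<^sup>2"
proof -
  let ?s = "sqrt ((spectral_norm A)\<^sup>2 + (spectral_norm B)\<^sup>2)"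
  have "spectral_norm (A @\<^sub>c B) \<le> ?s"
  proof (rule spectral_norm_leI)
    show "dim_col (A @\<^sub>c B) = n + k" using A B by simp
    fix z :: "real vec" assume z: "z \<in> carrier_vec (n + k)"
    define x y where "x = vec_first z n" and "y = vec_last z k"
    have xy: "x \<in> carrier_vec n" "y \<in> carrier_vec k" "z = x @\<^sub>v y"
      using z unfolding x_def y_def by (auto simp: vec_first_last_append)
    have "euclid_norm ((A @\<^sub>c B) *\<^sub>v z) \<le> euclid_norm (A *\<^sub>v x) + euclid_norm (B *\<^sub>v y)"
      unfolding xy(3) mult_append_cols_vec [OF A B xy(1,2)]
      using A B xy(1,2) by (intro euclid_norm_triangle [of _ m]) auto
    also have "\<dots> \<le> spectral_norm A * euclid_norm x + spectral_norm B * euclid_norm y"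
      by (intro add_mono euclid_norm_mult_le_spectral [OF A xy(1)] euclid_norm_mult_le_spectral [OF B xy(2)])
    also have "\<dots> \<le> ?s * sqrt ((euclid_norm x)\<^sup>2 + (euclid_norm y)\<^sup>2)"
      by (rule mult_add_mult_le_sqrt)
    also have "sqrt ((euclid_norm x)\<^sup>2 + (euclid_norm y)\<^sup>2) = euclid_norm z"
      unfolding xy(3) euclid_norm_append_square [symmetric] by simp
    finally show "euclid_norm ((A @\<^sub>c B) *\<^sub>v z) \<le> ?s * euclid_norm z" .
  qed auto
  then have "(spectral_norm (A @\<^sub>c B))\<^sup>2 \<le> ?s\<^sup>2" by (intro power_mono) auto
  then show ?thesis by simp
qed

section \<open>The pseudoinverse of a matrix of full column rank\<close>

text \<open>The Penrose conditions say that \<open>A B\<close> is symmetric and fixes the columns of \<open>A\<close>: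
  \<open>A\<^sup>T A B = A\<^sup>T (A B)\<^sup>T = (A B A)\<^sup>T = A\<^sup>T\<close>.\<close>

lemma penrose_inverse_normal_equations:
  assumes "A \<in> carrier_mat m n" "penrose_inverse A B"
  shows "transpose_mat A * (A * B) = transpose_mat A"
proof -
  have B: "B \<in> carrier_mat n m" and ABA: "A * B * A = A" and sym: "transpose_mat (A * B) = A * B"
    using assms unfolding penrose_inverse_def by auto
  have "transpose_mat A * (A * B) = transpose_mat A * transpose_mat (A * B)" by (simp only: sym)
  also have "\<dots> = transpose_mat (A * B * A)"
    by (rule transpose_mult [symmetric]) (use assms(1) B in auto)
  finally show ?thesis by (simp only: ABA)
qed

lemma penrose_inverse_of_left_inverse_gram:
  assumes A: "A \<in> carrier_mat m n" and C: "C \<in> carrier_mat n n"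
    and CG: "C * (transpose_mat A * A) = 1\<^sub>m n" and GC: "(transpose_mat A * A) * C = 1\<^sub>m n"
  shows "penrose_inverse A (C * transpose_mat A)"
proof -
  let ?G = "transpose_mat A * A"
  have At: "transpose_mat A \<in> carrier_mat n m" and G: "?G \<in> carrier_mat n n"
    and Ct: "transpose_mat C \<in> carrier_mat n n" and B: "C * transpose_mat A \<in> carrier_mat n m"
    using A C by auto
  have Gt: "transpose_mat ?G = ?G" using transpose_mult [OF At A] by simp
  have "transpose_mat C * ?G = transpose_mat (?G * C)"
    using transpose_mult [OF G C] Gt by simp
  then have CtG: "transpose_mat C * ?G = 1\<^sub>m n" using GC by simp
  have "transpose_mat C = transpose_mat C * (?G * C)" using GC Ct by simp
  also have "\<dots> = C"
    using assoc_mult_mat [OF Ct G C] CtG C by simp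
  finally have Ct_eq: "transpose_mat C = C" .
  have BA: "C * transpose_mat A * A = 1\<^sub>m n" using assoc_mult_mat [OF C At A] CG by simp
  have "transpose_mat (A * (C * transpose_mat A)) = transpose_mat (C * transpose_mat A) * transpose_mat A"
    by (rule transpose_mult [OF A B])
  also have "transpose_mat (C * transpose_mat A) = A * C"
    using transpose_mult [OF C At] Ct_eq by simp
  also have "A * C * transpose_mat A = A * (C * transpose_mat A)" by (rule assoc_mult_mat [OF A C At])
  finally have AB_sym: "transpose_mat (A * (C * transpose_mat A)) = A * (C * transpose_mat A)" .
  show ?thesis
    unfolding penrose_inverse_def
  proof (intro conjI)
    show "C * transpose_mat A \<in> carrier_mat (dim_col A) (dim_row A)" using B A by auto
    show "A * (C * transpose_mat A) * A = A"
      using assoc_mult_mat [OF A B A] BA A by simp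
    show "C * transpose_mat A * A * (C * transpose_mat A) = C * transpose_mat A"
      unfolding BA by (rule left_mult_one_mat [OF B])
    show "transpose_mat (A * (C * transpose_mat A)) = A * (C * transpose_mat A)" by (rule AB_sym)
    show "transpose_mat (C * transpose_mat A * A) = C * transpose_mat A * A" unfolding BA by simp
  qed
qed

text \<open>A vector in the kernel of the Gram matrix \<open>A\<^sup>T A\<close> satisfies \<open>\<parallel>A x\<parallel>\<^sup>2 = (A\<^sup>T A x) \<bullet> x = 0\<close>, so
  injectivity of \<open>A\<close> makes the determinant of the Gram matrix nonzero.\<close>

lemma gram_inverse_of_injective:
  fixes A :: "real mat"
  assumes A: "A \<in> carrier_mat m n"
    and inj: "\<And>x. x \<in> carrier_vec n \<Longrightarrow> A *\<^sub>v x = 0\<^sub>v m \<Longrightarrow> x = 0\<^sub>v n"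
  obtains C where "C \<in> carrier_mat n n" "C * (transpose_mat A * A) = 1\<^sub>m n"
    "(transpose_mat A * A) * C = 1\<^sub>m n"
proof -
  let ?G = "transpose_mat A * A"
  have At: "transpose_mat A \<in> carrier_mat n m" and G: "?G \<in> carrier_mat n n" using A by auto
  have "det ?G \<noteq> 0"
  proof
    assume "det ?G = 0"
    then obtain x where x: "x \<in> carrier_vec n" "x \<noteq> 0\<^sub>v n" "?G *\<^sub>v x = 0\<^sub>v n"
      using det_0_iff_vec_prod_zero [OF G] by blast
    have Ax: "A *\<^sub>v x \<in> carrier_vec m" by (rule mult_mat_vec_carrier [OF A x(1)])
    have "(euclid_norm (A *\<^sub>v x))\<^sup>2 = (transpose_mat A *\<^sub>v (A *\<^sub>v x)) \<bullet> x"
      unfolding scalar_prod_self [symmetric]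
      by (rule transpose_vec_mult_scalar [symmetric, OF A x(1) Ax])
    also have "\<dots> = 0"
      unfolding assoc_mult_mat_vec [OF At A x(1), symmetric] x(3) using x(1) by simp
    finally have "A *\<^sub>v x = 0\<^sub>v m" using euclid_norm_eq_0_iff [OF Ax] by simp
    then show False using inj x by blast
  qed
  from det_non_zero_imp_unit [OF G this, of "()"] obtain C
    where "C \<in> carrier_mat n n" "C * ?G = 1\<^sub>m n" "?G * C = 1\<^sub>m n"
    unfolding Units_def by (auto simp: ring_mat_def)
  then show thesis by (rule that)
qed

text \<open>The definition of the pseudoinverse by a definite description is meaningful once a Penrose inverse
  exists and is unique. For an injective \<open>A\<close> both follow from the invertible Gram matrix: multiplying the
  normal equations by its inverse leaves \<open>(A\<^sup>T A)\<^sup>-\<^sup>1 A\<^sup>T\<close> as the only candidate.\<close>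

lemma penrose_inverse_pseudoinverse:
  assumes A: "A \<in> carrier_mat m n"
    and inj: "\<And>x. x \<in> carrier_vec n \<Longrightarrow> A *\<^sub>v x = 0\<^sub>v m \<Longrightarrow> x = 0\<^sub>v n"
  shows "penrose_inverse A (pseudoinverse A)"
proof -
  obtain C where C: "C \<in> carrier_mat n n" and CG: "C * (transpose_mat A * A) = 1\<^sub>m n"
    and GC: "(transpose_mat A * A) * C = 1\<^sub>m n"
    using gram_inverse_of_injective [OF A inj] by blast
  have At: "transpose_mat A \<in> carrier_mat n m" and G: "transpose_mat A * A \<in> carrier_mat n n"
    using A by auto
  have unique: "B = C * transpose_mat A" if "penrose_inverse A B" for B
  proof -
    have B: "B \<in> carrier_mat n m" using that A unfolding penrose_inverse_def by auto
    have "B = C * (transpose_mat A * A) * B" unfolding CG using B by simp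
    also have "\<dots> = C * (transpose_mat A * (A * B))"
      using assoc_mult_mat [OF C G B] assoc_mult_mat [OF At A B] by simp
    finally show ?thesis unfolding penrose_inverse_normal_equations [OF A that] .
  qed
  have "penrose_inverse A (C * transpose_mat A)"
    by (rule penrose_inverse_of_left_inverse_gram [OF A C CG GC])
  then show ?thesis
    unfolding pseudoinverse_def by (rule theI) (rule unique)
qed

section \<open>Regularised least squares\<close>

text \<open>The weak form of the normal equations \<open>(D\<^sup>T D + G\<^sup>T G) v = D\<^sup>T b\<close>, that is, of minimising
  \<open>\<parallel>b - D v\<parallel>\<^sup>2 + \<parallel>G v\<parallel>\<^sup>2\<close>. Stating it with test vectors lets the estimates below choose the test vector
  directly, without any matrix inverse.\<close>

definition regularised_solution :: "real mat \<Rightarrow> real mat \<Rightarrow> real vec \<Rightarrow> real vec \<Rightarrow> bool" where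
  "regularised_solution D G b v \<longleftrightarrow>
     (\<forall>w \<in> carrier_vec (dim_col D). (D *\<^sub>v w) \<bullet> (b - D *\<^sub>v v) = (G *\<^sub>v w) \<bullet> (G *\<^sub>v v))"

text \<open>The regularisation block alone makes the stacked matrix injective, whatever the data block is.\<close>

lemma injective_append_rows:
  assumes "D \<in> carrier_mat k n" "G \<in> carrier_mat l n" "0 < g"
    and "\<And>x. x \<in> carrier_vec n \<Longrightarrow> g * euclid_norm x \<le> euclid_norm (G *\<^sub>v x)"
    and "x \<in> carrier_vec n" "(D @\<^sub>r G) *\<^sub>v x = 0\<^sub>v (k + l)"
  shows "x = 0\<^sub>v n"
proof -
  have "(euclid_norm (D *\<^sub>v x))\<^sup>2 + (euclid_norm (G *\<^sub>v x))\<^sup>2 = (euclid_norm ((D @\<^sub>r G) *\<^sub>v x))\<^sup>2"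
    unfolding mat_mult_append [OF assms(1,2,5)] by (rule euclid_norm_append_square [symmetric])
  also have "\<dots> = 0" unfolding assms(6) by simp
  finally have "euclid_norm (G *\<^sub>v x) = 0" by (simp add: sum_power2_eq_zero_iff)
  then have "g * euclid_norm x \<le> 0" using assms(4,5) by fastforce
  then have "euclid_norm x = 0"
    using assms(3) euclid_norm_nonneg [of x] by (simp add: mult_le_0_iff)
  then show ?thesis using euclid_norm_eq_0_iff [OF assms(5)] by simp
qed

lemma pseudoinverse_append_rows_carrier:
  assumes D: "D \<in> carrier_mat k n" and G: "G \<in> carrier_mat l n" and g: "0 < g"
    and bound: "\<And>x. x \<in> carrier_vec n \<Longrightarrow> g * euclid_norm x \<le> euclid_norm (G *\<^sub>v x)"
  shows "pseudoinverse (D @\<^sub>r G) \<in> carrier_mat n (k + l)"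
proof -
  have DG: "D @\<^sub>r G \<in> carrier_mat (k + l) n" using D G by simp
  show ?thesis
    using penrose_inverse_pseudoinverse [OF DG injective_append_rows [OF D G g bound]] carrier_matD [OF DG]
    unfolding penrose_inverse_def by metis
qed

lemma regularised_solution_pseudoinverse:
  assumes D: "D \<in> carrier_mat k n" and G: "G \<in> carrier_mat l n" and g: "0 < g"
    and bound: "\<And>x. x \<in> carrier_vec n \<Longrightarrow> g * euclid_norm x \<le> euclid_norm (G *\<^sub>v x)"
    and b: "b \<in> carrier_vec k"
  shows "regularised_solution D G b (pseudoinverse (D @\<^sub>r G) *\<^sub>v (b @\<^sub>v 0\<^sub>v l))"
  unfolding regularised_solution_def
proof
  define A where "A = D @\<^sub>r G"
  define c where "c = b @\<^sub>v 0\<^sub>v l"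
  define v where "v = pseudoinverse A *\<^sub>v c"
  have A: "A \<in> carrier_mat (k + l) n" unfolding A_def using D G by simp
  have c: "c \<in> carrier_vec (k + l)" unfolding c_def using b by simp
  have pinv: "penrose_inverse A (pseudoinverse A)"
    using injective_append_rows [OF D G g bound]
    by (intro penrose_inverse_pseudoinverse [OF A]) (auto simp: A_def)
  then have P: "pseudoinverse A \<in> carrier_mat n (k + l)"
    using A unfolding penrose_inverse_def by auto
  have At: "transpose_mat A \<in> carrier_mat n (k + l)" using A by simp
  have v: "v \<in> carrier_vec n" unfolding v_def using P c by simp
  have Av: "A *\<^sub>v v \<in> carrier_vec (k + l)" by (rule mult_mat_vec_carrier [OF A v])
  have "transpose_mat A *\<^sub>v (A *\<^sub>v v) = (transpose_mat A * (A * pseudoinverse A)) *\<^sub>v c"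
    unfolding v_def
    using assoc_mult_mat_vec [OF A P c] assoc_mult_mat_vec [OF At mult_carrier_mat [OF A P] c] by simp
  then have normal: "transpose_mat A *\<^sub>v (A *\<^sub>v v) = transpose_mat A *\<^sub>v c"
    unfolding penrose_inverse_normal_equations [OF A pinv] .
  fix w :: "real vec" assume "w \<in> carrier_vec (dim_col D)"
  then have w: "w \<in> carrier_vec n" using D by simp
  have Dw: "D *\<^sub>v w \<in> carrier_vec k" and Gw: "G *\<^sub>v w \<in> carrier_vec l"
    and Dv: "D *\<^sub>v v \<in> carrier_vec k" and Gv: "G *\<^sub>v v \<in> carrier_vec l"
    using mult_mat_vec_carrier D G v w by blast+
  have Aw: "A *\<^sub>v w \<in> carrier_vec (k + l)" by (rule mult_mat_vec_carrier [OF A w])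
  have test: "(A *\<^sub>v w) \<bullet> y = (transpose_mat A *\<^sub>v y) \<bullet> w" if y: "y \<in> carrier_vec (k + l)" for y
    unfolding transpose_vec_mult_scalar [OF A w y] by (rule comm_scalar_prod [OF Aw y])
  have "(A *\<^sub>v w) \<bullet> (A *\<^sub>v v) = (A *\<^sub>v w) \<bullet> c"
    unfolding test [OF Av] test [OF c] normal ..
  moreover have "(A *\<^sub>v w) \<bullet> (A *\<^sub>v v) = (D *\<^sub>v w) \<bullet> (D *\<^sub>v v) + (G *\<^sub>v w) \<bullet> (G *\<^sub>v v)"
    unfolding A_def mat_mult_append [OF D G v] mat_mult_append [OF D G w]
    by (rule scalar_prod_append [OF Dw Gw Dv Gv])
  moreover have "(A *\<^sub>v w) \<bullet> c = (D *\<^sub>v w) \<bullet> b"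
    unfolding A_def c_def mat_mult_append [OF D G w]
    using scalar_prod_append [OF Dw Gw b zero_carrier_vec] Gw by simp
  ultimately show "(D *\<^sub>v w) \<bullet> (b - D *\<^sub>v (pseudoinverse (D @\<^sub>r G) *\<^sub>v (b @\<^sub>v 0\<^sub>v l)))
      = (G *\<^sub>v w) \<bullet> (G *\<^sub>v (pseudoinverse (D @\<^sub>r G) *\<^sub>v (b @\<^sub>v 0\<^sub>v l)))"
    unfolding A_def [symmetric] c_def [symmetric] v_def [symmetric] scalar_prod_minus_distrib [OF Dw b Dv]
    by simp
qed

text \<open>Testing with \<open>w = v\<close> gives \<open>\<parallel>u\<parallel>\<^sup>2 + \<parallel>G v\<parallel>\<^sup>2 = b \<bullet> u\<close> for the residual \<open>u = b - D v\<close>. Controlling residual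
  and regularised solution by the data at the same time is what gives the constant \<open>1\<close> in the
  perturbation bound.\<close>

lemma regularised_solution_energy:
  assumes D: "D \<in> carrier_mat k n" and G: "G \<in> carrier_mat l n"
    and b: "b \<in> carrier_vec k" and v: "v \<in> carrier_vec n" and sol: "regularised_solution D G b v"
  shows "(euclid_norm (b - D *\<^sub>v v))\<^sup>2 + (euclid_norm (G *\<^sub>v v))\<^sup>2 \<le> (euclid_norm b)\<^sup>2"
proof -
  define u where "u = b - D *\<^sub>v v"
  have Dv: "D *\<^sub>v v \<in> carrier_vec k" by (rule mult_mat_vec_carrier [OF D v])
  have u: "u \<in> carrier_vec k" unfolding u_def using b Dv by simp
  have "(D *\<^sub>v v) \<bullet> u = (euclid_norm (G *\<^sub>v v))\<^sup>2"
    using sol v D unfolding regularised_solution_def u_def scalar_prod_self [symmetric] by auto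
  moreover have "u \<bullet> u = b \<bullet> u - (D *\<^sub>v v) \<bullet> u"
    using minus_scalar_prod_distrib [OF b Dv u] by (simp flip: u_def)
  ultimately have energy: "(euclid_norm u)\<^sup>2 + (euclid_norm (G *\<^sub>v v))\<^sup>2 = b \<bullet> u"
    by (simp add: scalar_prod_self)
  also have "\<dots> \<le> euclid_norm b * euclid_norm u"
    using Cauchy_Schwarz [OF b u] by linarith
  finally have le: "(euclid_norm u)\<^sup>2 + (euclid_norm (G *\<^sub>v v))\<^sup>2 \<le> euclid_norm b * euclid_norm u" .
  then have "euclid_norm u * euclid_norm u \<le> euclid_norm b * euclid_norm u"
    by (simp add: power2_eq_square) (smt (verit) zero_le_square)
  then have "euclid_norm u \<le> euclid_norm b"
    using euclid_norm_nonneg [of u] euclid_norm_nonneg [of b]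
    by (cases "euclid_norm u = 0") (simp_all add: mult_le_cancel_right)
  then have "euclid_norm b * euclid_norm u \<le> (euclid_norm b)\<^sup>2"
    by (simp add: power2_eq_square mult_left_mono)
  with le show ?thesis unfolding u_def by linarith
qed

lemma regularised_solution_bound:
  assumes "D \<in> carrier_mat k n" "G \<in> carrier_mat l n" "0 < g"
    and "\<And>x. x \<in> carrier_vec n \<Longrightarrow> g * euclid_norm x \<le> euclid_norm (G *\<^sub>v x)"
    and "b \<in> carrier_vec k" "v \<in> carrier_vec n" "regularised_solution D G b v"
  shows "euclid_norm v \<le> 1 / g * euclid_norm b"
proof -
  have "(euclid_norm (G *\<^sub>v v))\<^sup>2 \<le> (euclid_norm b)\<^sup>2"
    using regularised_solution_energy [OF assms(1,2,5-7)] zero_le_power2 [of "euclid_norm (b - D *\<^sub>v v)"]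
    by linarith
  then have "euclid_norm (G *\<^sub>v v) \<le> euclid_norm b" by (rule power2_le_imp_le) simp
  then have "g * euclid_norm v \<le> euclid_norm b" using assms(4) [OF assms(6)] by linarith
  then show ?thesis using assms(3) by (simp add: field_simps)
qed

text \<open>For an invertible \<open>G\<close>, residual \<open>u\<close> and rescaled solution \<open>G v\<close> solve a block system with matrix
  \<open>[[1, B], [-B\<^sup>T, 1]]\<close>, where \<open>B = D G\<^sup>-\<^sup>1\<close>. This is the identity plus a skew-symmetric matrix, so its
  inverse is a contraction, and by the resolvent identity the inverse changes by at most as much as the
  matrix, that is, by at most \<open>\<parallel>E\<parallel> / g\<close> for \<open>E = D' - D\<close>. Passing from \<open>\<parallel>G (v' - v)\<parallel>\<close> to \<open>\<parallel>v' - v\<parallel>\<close>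
  costs the second factor \<open>1 / g\<close>. The proof is this argument written with test vectors. The constant
  is \<open>1\<close>; a bound obtained by treating the two occurrences of \<open>D\<close> in \<open>(D\<^sup>T D + G\<^sup>T G)\<^sup>-\<^sup>1 D\<^sup>T\<close> one after the other would lose a factor.\<close>

lemma regularised_solution_perturbation:
  assumes D: "D \<in> carrier_mat k n" and D': "D' \<in> carrier_mat k n" and G: "G \<in> carrier_mat l n"
    and g: "0 < g"
    and bound: "\<And>x. x \<in> carrier_vec n \<Longrightarrow> g * euclid_norm x \<le> euclid_norm (G *\<^sub>v x)"
    and b: "b \<in> carrier_vec k" and v: "v \<in> carrier_vec n" and v': "v' \<in> carrier_vec n"
    and sol: "regularised_solution D G b v" and sol': "regularised_solution D' G b v'"
  shows "euclid_norm (v' - v) \<le> spectral_norm (D' - D) / g\<^sup>2 * euclid_norm b"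
proof -
  define E where "E = D' - D"
  define e where "e = spectral_norm E"
  define z where "z = v' - v"
  define u where "u = b - D *\<^sub>v v"
  define u' where "u' = b - D' *\<^sub>v v'"
  define s where "s = u' - u"
  have E: "E \<in> carrier_mat k n" and z: "z \<in> carrier_vec n" unfolding E_def z_def using D D' v v' by auto
  have carr: "M *\<^sub>v x \<in> carrier_vec k" if "M \<in> carrier_mat k n" "x \<in> carrier_vec n" for M :: "real mat" and x
    by (rule mult_mat_vec_carrier [OF that])
  have u: "u \<in> carrier_vec k" and u': "u' \<in> carrier_vec k"
    unfolding u_def u'_def using b carr [OF D v] carr [OF D' v'] by auto
  have s: "s \<in> carrier_vec k" unfolding s_def using u u' by simp
  have Dz: "D *\<^sub>v z \<in> carrier_vec k" "D' *\<^sub>v z \<in> carrier_vec k" "E *\<^sub>v z \<in> carrier_vec k"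
    and Ev: "E *\<^sub>v v \<in> carrier_vec k" and Gv: "G *\<^sub>v v \<in> carrier_vec l" "G *\<^sub>v v' \<in> carrier_vec l"
    and Gz: "G *\<^sub>v z \<in> carrier_vec l"
    using carr D D' E z v mult_mat_vec_carrier [OF G] v' by auto
  have ED: "D' *\<^sub>v x = D *\<^sub>v x + E *\<^sub>v x" if x: "x \<in> carrier_vec n" for x
  proof -
    have "D' = D + E" unfolding E_def using D D' by auto
    then show ?thesis using add_mult_distrib_mat_vec [OF D E x] by simp
  qed
  have D'z: "D' *\<^sub>v z = D' *\<^sub>v v' - D' *\<^sub>v v"
    unfolding z_def by (rule mult_minus_distrib_mat_vec [OF D' v' v])
  have cancel: "(b - q) - (b - p) = - (q - (p + e)) - e"
    if "p \<in> carrier_vec k" "q \<in> carrier_vec k" "e \<in> carrier_vec k" for p q e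
    using b that by (intro eq_vecI) auto
  have s_eq: "s = - (D' *\<^sub>v z) - E *\<^sub>v v"
    unfolding s_def u_def u'_def D'z ED [OF v]
    by (rule cancel [OF carr [OF D v] carr [OF D' v'] Ev])
  have Gz_eq: "G *\<^sub>v z = G *\<^sub>v v' - G *\<^sub>v v"
    unfolding z_def by (rule mult_minus_distrib_mat_vec [OF G v' v])
  have w1: "(D' *\<^sub>v z) \<bullet> u' = (G *\<^sub>v z) \<bullet> (G *\<^sub>v v')"
    using sol' z D' unfolding regularised_solution_def u'_def by auto
  have w2: "(D *\<^sub>v z) \<bullet> u = (G *\<^sub>v z) \<bullet> (G *\<^sub>v v)"
    using sol z D unfolding regularised_solution_def u_def by auto
  have "(D' *\<^sub>v z) \<bullet> s = (D' *\<^sub>v z) \<bullet> u' - (D' *\<^sub>v z) \<bullet> u"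
    unfolding s_def by (rule scalar_prod_minus_distrib [OF Dz(2) u' u])
  also have "(D' *\<^sub>v z) \<bullet> u = (D *\<^sub>v z) \<bullet> u + (E *\<^sub>v z) \<bullet> u"
    unfolding ED [OF z] by (rule add_scalar_prod_distrib [OF Dz(1,3) u])
  finally have "(D' *\<^sub>v z) \<bullet> s = (G *\<^sub>v z) \<bullet> (G *\<^sub>v z) - (E *\<^sub>v z) \<bullet> u"
    unfolding w1 w2 using scalar_prod_minus_distrib [OF Gz Gv(2,1)] by (simp flip: Gz_eq)
  moreover have "s \<bullet> s = - ((D' *\<^sub>v z) \<bullet> s) - (E *\<^sub>v v) \<bullet> s"
  proof -
    have "s \<bullet> s = (- (D' *\<^sub>v z) - E *\<^sub>v v) \<bullet> s" by (rule arg_cong [OF s_eq])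
    also have "\<dots> = (- (D' *\<^sub>v z)) \<bullet> s - (E *\<^sub>v v) \<bullet> s"
      by (rule minus_scalar_prod_distrib [OF _ Ev s]) (use Dz in simp)
    finally show ?thesis
      unfolding scalar_prod_uminus_left [OF trans [OF carrier_vecD [OF Dz(2)] carrier_vecD [OF s, symmetric]]] .
  qed
  \<comment> \<open>Testing both equations with \<open>z\<close> makes the terms in \<open>D' z\<close> cancel; only terms containing \<open>E\<close> remain.\<close>
  ultimately have energy: "(euclid_norm s)\<^sup>2 + (euclid_norm (G *\<^sub>v z))\<^sup>2 = (E *\<^sub>v z) \<bullet> u - (E *\<^sub>v v) \<bullet> s"
    by (simp add: scalar_prod_self)
  have e0: "0 \<le> e" unfolding e_def by simp
  have cross: "\<bar>(E *\<^sub>v x) \<bullet> y\<bar> \<le> e / g * (euclid_norm (G *\<^sub>v x) * euclid_norm y)"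
    if x: "x \<in> carrier_vec n" and y: "y \<in> carrier_vec k" for x y
  proof -
    have "\<bar>(E *\<^sub>v x) \<bullet> y\<bar> \<le> euclid_norm (E *\<^sub>v x) * euclid_norm y"
      by (rule Cauchy_Schwarz [OF carr [OF E x] y])
    also have "\<dots> \<le> (e * euclid_norm x) * euclid_norm y"
      unfolding e_def by (intro mult_right_mono euclid_norm_mult_le_spectral [OF E x]) simp
    also have "\<dots> \<le> (e * (euclid_norm (G *\<^sub>v x) / g)) * euclid_norm y"
      using bound [OF x] g e0 by (intro mult_right_mono mult_left_mono) (auto simp: field_simps)
    finally show ?thesis by simp
  qed
  \<comment> \<open>\<open>?S\<close> is the energy norm of the difference of the two solution pairs; the energy norm of the
    unperturbed pair is at most \<open>\<parallel>b\<parallel>\<close>.\<close>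
  let ?S = "sqrt ((euclid_norm (G *\<^sub>v z))\<^sup>2 + (euclid_norm s)\<^sup>2)"
  have "?S * ?S = (euclid_norm (G *\<^sub>v z))\<^sup>2 + (euclid_norm s)\<^sup>2" by simp
  also have "\<dots> = (E *\<^sub>v z) \<bullet> u - (E *\<^sub>v v) \<bullet> s" using energy by linarith
  also have "\<dots> \<le> e / g * (euclid_norm (G *\<^sub>v z) * euclid_norm u + euclid_norm s * euclid_norm (G *\<^sub>v v))"
    using cross [OF z u] cross [OF v s] by (simp add: distrib_left mult.commute abs_le_iff)
  also have "\<dots> \<le> e / g * (?S * sqrt ((euclid_norm u)\<^sup>2 + (euclid_norm (G *\<^sub>v v))\<^sup>2))"
    using e0 g by (intro mult_left_mono mult_add_mult_le_sqrt) auto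
  also have "\<dots> \<le> e / g * (?S * euclid_norm b)"
    using regularised_solution_energy [OF D G b v sol] e0 g
    by (intro mult_left_mono real_le_lsqrt) (auto simp: u_def)
  finally have "?S * ?S \<le> ?S * (e / g * euclid_norm b)" by (simp add: mult_ac)
  then have S_le: "?S \<le> e / g * euclid_norm b"
    by (rule le_of_mult_self_le) (use e0 g in auto)
  have "g * euclid_norm z \<le> euclid_norm (G *\<^sub>v z)" by (rule bound [OF z])
  also have "\<dots> \<le> ?S" by (rule real_le_rsqrt) simp
  also note S_le
  finally show ?thesis
    using g unfolding z_def e_def E_def by (simp add: field_simps power2_eq_square)
qed

section \<open>Operators obtained from stacked data\<close>

text \<open>Right-hand side and data matrix are changed one at a time, with \<open>M\<close> pairing the new data matrix with
  the old right-hand side. By linearity the first change is itself a regularised solution, for the data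
  \<open>R' - R\<close>; the second is the perturbation bound for each column.\<close>

lemma frobenius_norm_pseudoinverse_perturbation:
  assumes D: "D \<in> carrier_mat k n" and D': "D' \<in> carrier_mat k n" and G: "G \<in> carrier_mat l n"
    and g: "0 < g"
    and bound: "\<And>x. x \<in> carrier_vec n \<Longrightarrow> g * euclid_norm x \<le> euclid_norm (G *\<^sub>v x)"
    and R: "R \<in> carrier_mat k q" and R': "R' \<in> carrier_mat k q"
    and Q: "Q = pseudoinverse (D @\<^sub>r G) * (R @\<^sub>r 0\<^sub>m l q)"
    and Q': "Q' = pseudoinverse (D' @\<^sub>r G) * (R' @\<^sub>r 0\<^sub>m l q)"
  shows "frobenius_norm (Q' - Q)
    \<le> 1 / g * frobenius_norm (R' - R) + spectral_norm (D' - D) / g\<^sup>2 * frobenius_norm R"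
proof -
  have pinv: "pseudoinverse (H @\<^sub>r G) \<in> carrier_mat n (k + l)" if "H \<in> carrier_mat k n" for H
    by (rule pseudoinverse_append_rows_carrier [OF that G g bound])
  have stacked: "T @\<^sub>r 0\<^sub>m l q \<in> carrier_mat (k + l) q" if "T \<in> carrier_mat k q" for T :: "real mat"
    using that by simp
  have col_stacked: "col (T @\<^sub>r 0\<^sub>m l q) j = col T j @\<^sub>v 0\<^sub>v l"
    if "T \<in> carrier_mat k q" "j < q" for T :: "real mat" and j
    using that stacked [OF that(1)] unfolding append_rows_def by (intro eq_vecI) auto
  have col_op: "col (pseudoinverse (H @\<^sub>r G) * (T @\<^sub>r 0\<^sub>m l q)) j
      = pseudoinverse (H @\<^sub>r G) *\<^sub>v (col T j @\<^sub>v 0\<^sub>v l)"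
    if H: "H \<in> carrier_mat k n" and T: "T \<in> carrier_mat k q" and j: "j < q" for H T j
    unfolding col_mult2 [OF pinv [OF H] stacked [OF T] j] col_stacked [OF T j] ..
  have sol: "regularised_solution H G (col T j) (col (pseudoinverse (H @\<^sub>r G) * (T @\<^sub>r 0\<^sub>m l q)) j)"
    if H: "H \<in> carrier_mat k n" and T: "T \<in> carrier_mat k q" and j: "j < q" for H T j
    unfolding col_op [OF that]
    by (rule regularised_solution_pseudoinverse [OF H G g bound]) (use T in auto)
  define M where "M = pseudoinverse (D' @\<^sub>r G) * (R @\<^sub>r 0\<^sub>m l q)"
  have M: "M \<in> carrier_mat n q" and Qc: "Q \<in> carrier_mat n q" and Qc': "Q' \<in> carrier_mat n q"
    unfolding M_def Q Q'
    using mult_carrier_mat [OF pinv [OF D'] stacked [OF R]] mult_carrier_mat [OF pinv [OF D] stacked [OF R]]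
      mult_carrier_mat [OF pinv [OF D'] stacked [OF R']] .
  have dR: "R' - R \<in> carrier_mat k q" using R R' by auto
  have "Q' - M = pseudoinverse (D' @\<^sub>r G) * ((R' @\<^sub>r 0\<^sub>m l q) - (R @\<^sub>r 0\<^sub>m l q))"
    unfolding Q' M_def
    by (rule mult_minus_distrib_mat [symmetric, OF pinv [OF D'] stacked [OF R'] stacked [OF R]])
  also have "(R' @\<^sub>r 0\<^sub>m l q) - (R @\<^sub>r 0\<^sub>m l q) = (R' - R) @\<^sub>r 0\<^sub>m l q"
    using R R' unfolding append_rows_def by (intro eq_matI) auto
  finally have diff: "Q' - M = pseudoinverse (D' @\<^sub>r G) * ((R' - R) @\<^sub>r 0\<^sub>m l q)" .
  have first: "frobenius_norm (Q' - M) \<le> 1 / g * frobenius_norm (R' - R)"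
  proof (rule frobenius_norm_le_colwise)
    show "dim_col (Q' - M) = dim_col (R' - R)" using M R by simp
    show "0 \<le> 1 / g" using g by simp
    fix j assume "j < dim_col (R' - R)"
    then have j: "j < q" using R by simp
    have "col (Q' - M) j \<in> carrier_vec n"
      using M by (auto intro!: carrier_vecI)
    moreover have "col (R' - R) j \<in> carrier_vec k"
      using R by (auto intro!: carrier_vecI)
    ultimately show "euclid_norm (col (Q' - M) j) \<le> 1 / g * euclid_norm (col (R' - R) j)"
      using sol [OF D' dR j] unfolding diff
      by (intro regularised_solution_bound [OF D' G g bound])
  qed
  have second: "frobenius_norm (M - Q) \<le> spectral_norm (D' - D) / g\<^sup>2 * frobenius_norm R"
  proof (rule frobenius_norm_le_colwise)
    show "dim_col (M - Q) = dim_col R" using Qc R by simp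
    show "0 \<le> spectral_norm (D' - D) / g\<^sup>2" by simp
    fix j assume "j < dim_col R"
    then have j: "j < q" using R by simp
    have "col (M - Q) j = col M j - col Q j" using M Qc j by (intro eq_vecI) auto
    also have "euclid_norm \<dots> \<le> spectral_norm (D' - D) / g\<^sup>2 * euclid_norm (col R j)"
      by (rule regularised_solution_perturbation [OF D D' G g bound])
        (use sol [OF D R j] sol [OF D' R j] M Qc R in \<open>auto simp: M_def [symmetric] Q [symmetric] intro!: carrier_vecI\<close>)
    finally show "euclid_norm (col (M - Q) j) \<le> spectral_norm (D' - D) / g\<^sup>2 * euclid_norm (col R j)" .
  qed
  have "Q' - Q = (Q' - M) + (M - Q)" using M Qc Qc' by (intro eq_matI) auto
  then have "frobenius_norm (Q' - Q) \<le> frobenius_norm (Q' - M) + frobenius_norm (M - Q)"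
    using frobenius_norm_triangle [OF minus_carrier_mat [OF M] minus_carrier_mat [OF Qc]] by simp
  then show ?thesis using first second by linarith
qed

lemma euclid_norm_mat_diag_ge:
  assumes "\<And>i. i < d \<Longrightarrow> g \<le> f i" "0 \<le> g" "x \<in> carrier_vec d"
  shows "g * euclid_norm x \<le> euclid_norm (mat_diag d f *\<^sub>v x)"
proof -
  have dim: "dim_row (mat_diag d f) = d" by (simp add: mat_diag_def)
  have entry: "(mat_diag d f *\<^sub>v x) $ i = f i * x $ i" if i: "i < d" for i
  proof -
    have "(mat_diag d f *\<^sub>v x) $ i = (\<Sum>j\<in>{0..<d}. (if i = j then f j else 0) * x $ j)"
      using assms(3) i by (simp add: mat_diag_def scalar_prod_def)
    also have "\<dots> = (\<Sum>j\<in>{0..<d}. if j = i then f i * x $ i else 0)"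
      by (intro sum.cong) auto
    finally show ?thesis using i by simp
  qed
  have "g * euclid_norm x = L2_set (\<lambda>i. \<bar>g * x $ i\<bar>) {0..<d}"
    using assms(2,3) unfolding euclid_norm_eq_L2_set
    by (simp add: L2_set_right_distrib) (simp add: L2_set_def)
  also have "\<dots> \<le> L2_set (\<lambda>i. \<bar>f i * x $ i\<bar>) {0..<d}"
  proof (rule L2_set_mono)
    fix i assume "i \<in> {0..<d}"
    then have "g \<le> f i" using assms(1) by simp
    then show "\<bar>g * x $ i\<bar> \<le> \<bar>f i * x $ i\<bar>"
      using assms(2) by (auto simp: abs_mult intro!: mult_right_mono)
  qed simp
  also have "\<dots> = L2_set (\<lambda>i. f i * x $ i) {0..<d}" by (simp add: L2_set_def)
  also have "\<dots> = euclid_norm (mat_diag d f *\<^sub>v x)"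
    unfolding euclid_norm_eq_L2_set
    by (rule L2_set_cong) (auto simp: entry dim simp del: index_mult_mat_vec)
  finally show ?thesis .
qed

lemma append_rows_perturbation:
  fixes A :: "'a :: ab_group_add mat"
  assumes "A \<in> carrier_mat k n" "A' \<in> carrier_mat k n" "E \<in> carrier_mat k n" "B \<in> carrier_mat l n"
    and eq: "A' @\<^sub>r B = (A @\<^sub>r B) + (E @\<^sub>r 0\<^sub>m l n)"
  shows "E = A' - A"
proof (rule eq_matI)
  fix i j assume ij: "i < dim_row (A' - A)" "j < dim_col (A' - A)"
  have upper: "(M @\<^sub>r N) $$ (i,j) = M $$ (i,j)"
    if "M \<in> carrier_mat k n" "N \<in> carrier_mat l n" for M N :: "'a mat"
    using that ij assms(1,2) unfolding append_rows_def by auto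
  have "(A' @\<^sub>r B) $$ (i,j) = ((A @\<^sub>r B) + (E @\<^sub>r 0\<^sub>m l n)) $$ (i,j)" by (simp only: eq)
  also have "\<dots> = (A @\<^sub>r B) $$ (i,j) + (E @\<^sub>r 0\<^sub>m l n) $$ (i,j)"
    using ij assms(1,2) carrier_append_rows [OF assms(3) zero_carrier_mat [of l n]]
    by (intro index_add_mat) auto
  finally have "A' $$ (i,j) = A $$ (i,j) + E $$ (i,j)"
    unfolding upper [OF assms(2,4)] upper [OF assms(1,4)] upper [OF assms(3) zero_carrier_mat] .
  then show "E $$ (i,j) = (A' - A) $$ (i,j)" using ij assms(1,2) by simp
qed (use assms in auto)

section \<open>Projected data\<close>

lemma projected_data_carrier:
  assumes "V \<in> carrier_mat n r" "X \<in> carrier_mat n K" "U \<in> carrier_mat m K"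
  shows "projected_data V X U \<in> carrier_mat K (r + r\<^sup>2 + m + 1)"
  using assms unfolding projected_data_def Let_def by (auto simp: power2_eq_square)

lemma projected_rhs_carrier:
  assumes "V \<in> carrier_mat n r" "Y \<in> carrier_mat n K"
  shows "projected_rhs V Y \<in> carrier_mat K r"
  using assms unfolding projected_rhs_def by auto

lemma spectral_norm_projection_le:
  assumes V: "V \<in> carrier_mat n r" and X: "X \<in> carrier_mat n K"
    and "spectral_norm V \<le> t" "spectral_norm X \<le> s"
  shows "spectral_norm (transpose_mat V * X) \<le> t * s"
proof -
  have t: "0 \<le> t" using assms(3) spectral_norm_nonneg [of V] by linarith
  have "spectral_norm (transpose_mat V * X) \<le> spectral_norm (transpose_mat V) * spectral_norm X"
    by (rule spectral_norm_mult [of _ r n _ K]) (use V X in auto)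
  also have "\<dots> \<le> t * s" using assms(3,4) t by (intro mult_mono) auto
  finally show ?thesis .
qed

lemma transpose_minus_mult:
  fixes V :: "'a :: comm_ring mat"
  assumes "V \<in> carrier_mat n r" "V' \<in> carrier_mat n r" "X \<in> carrier_mat n K"
  shows "transpose_mat V' * X - transpose_mat V * X = transpose_mat (V' - V) * X"
proof -
  have "transpose_mat (V' - V) = transpose_mat V' - transpose_mat V"
    using assms by (intro eq_matI) auto
  then show ?thesis
    using minus_mult_distrib_mat [of "transpose_mat V'" r n "transpose_mat V" X K] assms by simp
qed

text \<open>Only the linear block \<open>V\<^sup>T X\<close> and the quadratic block depend on \<open>V\<close>. The linear block changes by at most
  \<open>t s\<close>, the quadratic block by the product rule by at most \<open>2 s (t s)\<close>, and the squares of the norms of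
  column blocks add up.\<close>

lemma spectral_norm_projected_data_diff:
  assumes V: "V \<in> carrier_mat n r" and V': "V' \<in> carrier_mat n r"
    and X: "X \<in> carrier_mat n K" and U: "U \<in> carrier_mat m K"
    and V1: "spectral_norm V \<le> 1" and V'1: "spectral_norm V' \<le> 1"
    and t: "spectral_norm (V' - V) \<le> t" and s: "spectral_norm X \<le> s"
  shows "(spectral_norm (projected_data V' X U - projected_data V X U))\<^sup>2
    \<le> (t * s)\<^sup>2 + (2 * s * (t * s))\<^sup>2"
proof -
  define Z where "Z = transpose_mat V * X"
  define Z' where "Z' = transpose_mat V' * X"
  have Z: "Z \<in> carrier_mat r K" and Z': "Z' \<in> carrier_mat r K"
    unfolding Z_def Z'_def using V V' X by auto
  define F where "F = transpose_mat Z' - transpose_mat Z"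
  define H where "H = transpose_mat (khatri_rao Z' Z') - transpose_mat (khatri_rao Z Z)"
  have F_eq: "F = transpose_mat (Z' - Z)" and H_eq: "H = transpose_mat (khatri_rao Z' Z' - khatri_rao Z Z)"
    unfolding F_def H_def using Z Z' by (auto intro!: eq_matI)
  have Fc: "F \<in> carrier_mat K r" and Hc: "H \<in> carrier_mat K (r * r)"
    unfolding F_def H_def using Z Z' by auto
  have s0: "0 \<le> s" and t0: "0 \<le> t"
    using s t spectral_norm_nonneg [of X] spectral_norm_nonneg [of "V' - V"] by linarith+
  have dZ: "spectral_norm (Z' - Z) \<le> t * s"
    unfolding Z_def Z'_def transpose_minus_mult [OF V V' X]
    by (rule spectral_norm_projection_le [OF _ X t s]) (use V V' in auto)
  have Zs: "spectral_norm Z \<le> s" "spectral_norm Z' \<le> s"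
    unfolding Z_def Z'_def
    using spectral_norm_projection_le [OF V X V1 s] spectral_norm_projection_le [OF V' X V'1 s] by auto
  have dZc: "Z' - Z \<in> carrier_mat r K" using Z Z' by auto
  have "spectral_norm (khatri_rao Z' Z' - khatri_rao Z Z)
      \<le> spectral_norm (khatri_rao Z' (Z' - Z)) + spectral_norm (khatri_rao (Z' - Z) Z)"
    unfolding khatri_rao_diff [OF Z' Z Z' Z]
    by (rule spectral_norm_triangle [of _ "r * r" K]) (use Z Z' in auto)
  also have "\<dots> \<le> spectral_norm Z' * spectral_norm (Z' - Z) + spectral_norm (Z' - Z) * spectral_norm Z"
    by (intro add_mono spectral_norm_khatri_rao [OF Z' dZc] spectral_norm_khatri_rao [OF dZc Z])
  also have "\<dots> \<le> s * (t * s) + (t * s) * s"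
    using dZ Zs s0 t0 by (intro add_mono mult_mono) auto
  finally have H: "spectral_norm H \<le> 2 * s * (t * s)"
    unfolding H_eq spectral_norm_transpose by (simp add: mult_ac)
  have F: "spectral_norm F \<le> t * s" unfolding F_eq spectral_norm_transpose by (rule dZ)
  have zero: "M - M = 0\<^sub>m K p" if "M \<in> carrier_mat K p" for M :: "real mat" and p
    using that by auto
  let ?one = "mat K 1 (\<lambda>_. 1) :: real mat"
  have T: "transpose_mat U @\<^sub>c ?one \<in> carrier_mat K (m + 1)" using U by auto
  have KR: "transpose_mat (khatri_rao Y Y) \<in> carrier_mat K (r * r)" if "Y \<in> carrier_mat r K" for Y
    using that by auto
  have KRT: "transpose_mat (khatri_rao Y Y) @\<^sub>c (transpose_mat U @\<^sub>c ?one)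
      \<in> carrier_mat K (r * r + (m + 1))" if "Y \<in> carrier_mat r K" for Y
    using that U by auto
  have tZ': "transpose_mat Z' \<in> carrier_mat K r" and tZ: "transpose_mat Z \<in> carrier_mat K r"
    using Z Z' by simp_all
  have "projected_data V' X U - projected_data V X U
      = (transpose_mat Z' @\<^sub>c (transpose_mat (khatri_rao Z' Z') @\<^sub>c (transpose_mat U @\<^sub>c ?one)))
        - (transpose_mat Z @\<^sub>c (transpose_mat (khatri_rao Z Z) @\<^sub>c (transpose_mat U @\<^sub>c ?one)))"
    using X unfolding projected_data_def Let_def Z_def Z'_def by simp
  also have "\<dots> = F @\<^sub>c (H @\<^sub>c 0\<^sub>m K (m + 1))"
    unfolding append_cols_diff [OF tZ' tZ KRT [OF Z'] KRT [OF Z]]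
      append_cols_diff [OF KR [OF Z'] KR [OF Z] T T] zero [OF T] F_def H_def ..
  finally have "(spectral_norm (projected_data V' X U - projected_data V X U))\<^sup>2
      = (spectral_norm (F @\<^sub>c (H @\<^sub>c 0\<^sub>m K (m + 1))))\<^sup>2" by simp
  also have "\<dots> \<le> (spectral_norm F)\<^sup>2 + (spectral_norm (H @\<^sub>c 0\<^sub>m K (m + 1)))\<^sup>2"
    by (rule spectral_norm_append_cols_square [OF Fc, of _ "r * r + (m + 1)"]) (use Hc in auto)
  also have "(spectral_norm (H @\<^sub>c 0\<^sub>m K (m + 1)))\<^sup>2 \<le> (spectral_norm H)\<^sup>2"
    using spectral_norm_append_cols_square [OF Hc zero_carrier_mat [of K "m + 1"]] by simp
  also have "(spectral_norm F)\<^sup>2 \<le> (t * s)\<^sup>2"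
    by (rule power_mono [OF F spectral_norm_nonneg])
  also have "(spectral_norm H)\<^sup>2 \<le> (2 * s * (t * s))\<^sup>2"
    by (rule power_mono [OF H spectral_norm_nonneg])
  finally show ?thesis by simp
qed

lemma frobenius_norm_projected_rhs:
  assumes V: "V \<in> carrier_mat n r" and X: "X \<in> carrier_mat n K" and L: "L \<in> carrier_mat K k"
    and s: "spectral_norm X \<le> s"
  shows "frobenius_norm (projected_rhs V (X * L)) \<le> frobenius_norm V * (s * spectral_norm L)"
proof -
  have "frobenius_norm (projected_rhs V (X * L)) = frobenius_norm (transpose_mat V * (X * L))"
    unfolding projected_rhs_def by (rule frobenius_norm_transpose)
  also have "\<dots> \<le> frobenius_norm (transpose_mat V) * spectral_norm (X * L)"
    by (rule frobenius_norm_mult_right [of _ r n _ k]) (use V X L in auto)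
  also have "\<dots> \<le> frobenius_norm V * (spectral_norm X * spectral_norm L)"
    unfolding frobenius_norm_transpose by (intro mult_left_mono spectral_norm_mult [OF X L]) simp
  also have "\<dots> \<le> frobenius_norm V * (s * spectral_norm L)"
    using s by (intro mult_left_mono mult_right_mono) auto
  finally show ?thesis .
qed

lemma projected_rhs_diff:
  assumes "V \<in> carrier_mat n r" "V' \<in> carrier_mat n r" "Y \<in> carrier_mat n K"
  shows "projected_rhs V' Y - projected_rhs V Y = projected_rhs (V' - V) Y"
  unfolding projected_rhs_def transpose_minus_mult [OF assms, symmetric]
  using assms by (intro eq_matI) auto

lemma frobenius_norm_orthonormal:
  assumes Q: "Q \<in> carrier_mat n r" and orth: "transpose_mat Q * Q = 1\<^sub>m r"
  shows "frobenius_norm Q = sqrt (real r)"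
proof -
  have "euclid_norm (col Q j) = 1" if "j < r" for j
  proof -
    have "col Q j \<bullet> col Q j = (transpose_mat Q * Q) $$ (j,j)" using Q that by simp
    then show ?thesis using that unfolding orth euclid_norm_def by simp
  qed
  then have "frobenius_norm Q = L2_set (\<lambda>j. 1) {..<r}"
    using Q unfolding frobenius_norm_eq_L2_set_cols by (intro L2_set_cong) auto
  then show ?thesis by (simp add: L2_set_constant)
qed

section \<open>The perturbation bounds\<close>

theorem theorem1:
  fixes n K m r d :: nat
    and X U \<Delta> Xdot :: "real mat"
    and V \<Sigma> W V\<^sub>r \<Sigma>\<^sub>r W\<^sub>r :: "real mat"
    and Xt Vt \<Sigma>t Wt Vt\<^sub>r \<Sigma>t\<^sub>r Wt\<^sub>r :: "real mat"
    and \<gamma> :: "nat \<Rightarrow> real" and \<Gamma> :: "real mat"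
    and Dbar Rbar Dt Rt E\<^sub>D E\<^sub>R Obatch Ostream :: "real mat"
    and \<sigma>\<^sub>1 \<tau>\<^sub>v \<epsilon> \<eta> \<alpha> \<beta>\<^sub>1 sqrt_\<gamma>_min :: real
  assumes "n > 0" and "K > 0" and "m > 0"
    and "1 \<le> r" and "r \<le> min n K"
    and "d = r + r\<^sup>2 + m + 1"
    and "X \<in> carrier_mat n K" and "U \<in> carrier_mat m K" and "\<Delta> \<in> carrier_mat K K"
    and "Xdot = X * \<Delta>"
    and "is_svd X V \<Sigma> W" and "leading_svd_factors r V \<Sigma> W V\<^sub>r \<Sigma>\<^sub>r W\<^sub>r"
    and "\<sigma>\<^sub>1 = \<Sigma> $$ (0,0)"
    and "Xt \<in> carrier_mat n K"
    and "is_svd Xt Vt \<Sigma>t Wt" and "leading_svd_factors r Vt \<Sigma>t Wt Vt\<^sub>r \<Sigma>t\<^sub>r Wt\<^sub>r"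
    and "\<tau>\<^sub>v = frobenius_norm (V\<^sub>r - Vt\<^sub>r)"
    and "spectral_norm (X - Xt) \<le> \<epsilon>"
    and "\<And>j. j < d \<Longrightarrow> \<gamma> j > 0"
    and "\<Gamma> = mat_diag d \<gamma>"
    and "sqrt_\<gamma>_min = Min ((\<lambda>j. sqrt (\<gamma> j)) ` {..<d})"
    and "Dbar = stacked_data V\<^sub>r X U \<Gamma>" and "Rbar = stacked_rhs V\<^sub>r Xdot d"
    and "Dt = stacked_data Vt\<^sub>r X U \<Gamma>" and "Rt = stacked_rhs Vt\<^sub>r Xdot d"
    and "E\<^sub>D \<in> carrier_mat K d" and "Dt = Dbar + (E\<^sub>D @\<^sub>r 0\<^sub>m d d)"
    and "E\<^sub>R \<in> carrier_mat K r" and "Rt = Rbar + (E\<^sub>R @\<^sub>r 0\<^sub>m d r)"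
    and "Obatch = pseudoinverse Dbar * Rbar"
    and "Ostream = pseudoinverse Dt * Rt"
    and "\<eta> = spectral_norm U"
    and "\<beta>\<^sub>1 = 2 * sqrt (\<sigma>\<^sub>1 ^ 4 + \<sigma>\<^sub>1\<^sup>2 + \<eta>\<^sup>2 + real K) * sqrt (real (min n K))"
    and "\<alpha> = (if K \<noteq> d then sqrt 2 else 1)"
  shows "spectral_norm E\<^sub>D \<le> \<beta>\<^sub>1 / sqrt (real (min n K)) * \<tau>\<^sub>v
    \<and> frobenius_norm E\<^sub>R \<le> \<sigma>\<^sub>1 * spectral_norm \<Delta> * \<tau>\<^sub>v
    \<and> frobenius_norm (Obatch - Ostream)
        \<le> \<sigma>\<^sub>1 * spectral_norm \<Delta> / sqrt_\<gamma>_min * \<tau>\<^sub>v * (1 + \<alpha> * \<beta>\<^sub>1 / sqrt_\<gamma>_min)"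
proof -
  define \<delta> where "\<delta> = spectral_norm \<Delta>"
  define \<kappa> where "\<kappa> = 2 * sqrt (\<sigma>\<^sub>1 ^ 4 + \<sigma>\<^sub>1\<^sup>2 + \<eta>\<^sup>2 + real K)"
  let ?N = "real (min n K)"
  have X: "X \<in> carrier_mat n K" and U: "U \<in> carrier_mat m K" and \<Delta>: "\<Delta> \<in> carrier_mat K K"
    by fact+
  have Xdot: "Xdot = X * \<Delta>" and d: "d = r + r\<^sup>2 + m + 1" by fact+
  have Xdotc: "Xdot \<in> carrier_mat n K" unfolding Xdot using X \<Delta> by auto
  have lead: "r \<le> dim_col V" "r \<le> dim_col W" "V\<^sub>r = leading_cols r V"
    and lead': "r \<le> dim_col Vt" "Vt\<^sub>r = leading_cols r Vt"
    using \<open>leading_svd_factors r V \<Sigma> W V\<^sub>r \<Sigma>\<^sub>r W\<^sub>r\<close> \<open>leading_svd_factors r Vt \<Sigma>t Wt Vt\<^sub>r \<Sigma>t\<^sub>r Wt\<^sub>r\<close>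
    unfolding leading_svd_factors_def by auto
  have svd: "dim_row V = dim_row X" "transpose_mat V * V = 1\<^sub>m (dim_col V)"
    and svd': "dim_row Vt = dim_row Xt" "transpose_mat Vt * Vt = 1\<^sub>m (dim_col Vt)"
    using \<open>is_svd X V \<Sigma> W\<close> \<open>is_svd Xt Vt \<Sigma>t Wt\<close> unfolding is_svd_def by blast+
  have Vr: "V\<^sub>r \<in> carrier_mat n r" unfolding lead(3)
    using leading_cols_carrier [of r V] svd(1) X by simp
  have Vt: "Vt\<^sub>r \<in> carrier_mat n r" unfolding lead'(2)
    using leading_cols_carrier [of r Vt] svd'(1) \<open>Xt \<in> carrier_mat n K\<close> by simp
  have orth: "transpose_mat V\<^sub>r * V\<^sub>r = 1\<^sub>m r" "transpose_mat Vt\<^sub>r * Vt\<^sub>r = 1\<^sub>m r"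
    unfolding lead(3) lead'(2)
    by (rule leading_cols_orthonormal [OF svd(2) lead(1)] leading_cols_orthonormal [OF svd'(2) lead'(1)])+
  have \<sigma>: "spectral_norm X \<le> \<sigma>\<^sub>1"
    unfolding \<open>\<sigma>\<^sub>1 = \<Sigma> $$ (0,0)\<close>
    by (rule spectral_norm_le_first_singular_value [OF \<open>is_svd X V \<Sigma> W\<close>])
      (use lead(1,2) \<open>1 \<le> r\<close> in auto)
  then have \<sigma>0: "0 \<le> \<sigma>\<^sub>1" using spectral_norm_nonneg [of X] by linarith
  have \<delta>0: "0 \<le> \<delta>" unfolding \<delta>_def by simp
  have dV: "frobenius_norm (Vt\<^sub>r - V\<^sub>r) = \<tau>\<^sub>v"
    unfolding \<open>\<tau>\<^sub>v = frobenius_norm (V\<^sub>r - Vt\<^sub>r)\<close> by (rule frobenius_norm_minus_commute [OF Vt Vr])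
  then have \<tau>: "spectral_norm (Vt\<^sub>r - V\<^sub>r) \<le> \<tau>\<^sub>v" and \<tau>0: "0 \<le> \<tau>\<^sub>v"
    using spectral_norm_le_frobenius [of "Vt\<^sub>r - V\<^sub>r"] frobenius_norm_nonneg [of "Vt\<^sub>r - V\<^sub>r"] by simp_all

  define D where "D = projected_data V\<^sub>r X U"
  define D' where "D' = projected_data Vt\<^sub>r X U"
  define R where "R = projected_rhs V\<^sub>r Xdot"
  define R' where "R' = projected_rhs Vt\<^sub>r Xdot"
  define G where "G = diag_sqrt \<Gamma>"
  have D: "D \<in> carrier_mat K d" and D': "D' \<in> carrier_mat K d"
    unfolding D_def D'_def d by (rule projected_data_carrier [OF _ X U], fact)+
  have R: "R \<in> carrier_mat K r" and R': "R' \<in> carrier_mat K r"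
    unfolding R_def R'_def by (rule projected_rhs_carrier [OF _ Xdotc], fact)+
  have G_eq: "G = mat_diag d (\<lambda>j. sqrt (\<gamma> j))"
    unfolding G_def diag_sqrt_def \<open>\<Gamma> = mat_diag d \<gamma>\<close> by (intro eq_matI) (auto simp: mat_diag_def)
  have G: "G \<in> carrier_mat d d" unfolding G_eq by simp
  have Dbar: "Dbar = D @\<^sub>r G" and Dt: "Dt = D' @\<^sub>r G"
    unfolding D_def D'_def G_def using \<open>Dbar = _\<close> \<open>Dt = stacked_data _ _ _ _\<close>
    by (simp_all only: stacked_data_def)
  have Rbar: "Rbar = R @\<^sub>r 0\<^sub>m d r" and Rt: "Rt = R' @\<^sub>r 0\<^sub>m d r"
    unfolding R_def R'_def \<open>Rbar = _\<close> \<open>Rt = stacked_rhs _ _ _\<close> stacked_rhs_def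
      carrier_matD(2) [OF Vr] carrier_matD(2) [OF Vt] by simp_all
  have E\<^sub>D: "E\<^sub>D = D' - D"
    by (rule append_rows_perturbation [OF D D' _ G])
      (use \<open>E\<^sub>D \<in> carrier_mat K d\<close> \<open>Dt = Dbar + _\<close> Dbar Dt in simp_all)
  have E\<^sub>R: "E\<^sub>R = R' - R"
    by (rule append_rows_perturbation [OF R R' _ zero_carrier_mat [of d r]])
      (use \<open>E\<^sub>R \<in> carrier_mat K r\<close> \<open>Rt = Rbar + _\<close> Rbar Rt in simp_all)

  \<comment> \<open>The coefficient \<open>\<sigma>\<^sub>1\<^sup>2 + 4 \<sigma>\<^sub>1\<^sup>4\<close> is at most \<open>4\<close> times the radicand in \<open>\<beta>\<^sub>1\<close>.\<close>
  have "(spectral_norm E\<^sub>D)\<^sup>2 \<le> (\<tau>\<^sub>v * \<sigma>\<^sub>1)\<^sup>2 + (2 * \<sigma>\<^sub>1 * (\<tau>\<^sub>v * \<sigma>\<^sub>1))\<^sup>2"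
    unfolding E\<^sub>D D_def D'_def
    by (rule spectral_norm_projected_data_diff [OF Vr Vt X U _ _ \<tau> \<sigma>])
      (rule spectral_norm_orthonormal_le_1 [OF Vr orth(1)] spectral_norm_orthonormal_le_1 [OF Vt orth(2)])+
  also have "\<dots> = (\<sigma>\<^sub>1\<^sup>2 + 4 * \<sigma>\<^sub>1 ^ 4) * \<tau>\<^sub>v\<^sup>2" by (simp add: power_mult_distrib algebra_simps eval_nat_numeral)
  also have "\<dots> \<le> (4 * (\<sigma>\<^sub>1 ^ 4 + \<sigma>\<^sub>1\<^sup>2 + \<eta>\<^sup>2 + real K)) * \<tau>\<^sub>v\<^sup>2"
    by (intro mult_right_mono) auto
  also have "\<dots> = (\<kappa> * \<tau>\<^sub>v)\<^sup>2" unfolding \<kappa>_def by (simp add: power_mult_distrib)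
  finally have E\<^sub>D_le: "spectral_norm E\<^sub>D \<le> \<kappa> * \<tau>\<^sub>v"
    by (rule power2_le_imp_le) (use \<tau>0 in \<open>simp add: \<kappa>_def\<close>)
  have N: "0 < ?N" and rN: "real r \<le> ?N" using \<open>r \<le> min n K\<close> \<open>1 \<le> r\<close> by simp_all
  have \<beta>: "\<beta>\<^sub>1 = \<kappa> * sqrt ?N" unfolding \<kappa>_def by fact
  have \<kappa>0: "0 \<le> \<kappa>" unfolding \<kappa>_def by simp

  have "E\<^sub>R = projected_rhs (Vt\<^sub>r - V\<^sub>r) (X * \<Delta>)"
    unfolding E\<^sub>R R_def R'_def Xdot by (rule projected_rhs_diff [OF Vr Vt]) (use Xdotc Xdot in simp)
  then have "frobenius_norm E\<^sub>R \<le> frobenius_norm (Vt\<^sub>r - V\<^sub>r) * (\<sigma>\<^sub>1 * \<delta>)"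
    unfolding \<delta>_def using frobenius_norm_projected_rhs [OF minus_carrier_mat [OF Vr] X \<Delta> \<sigma>] by simp
  then have E\<^sub>R_le: "frobenius_norm E\<^sub>R \<le> \<sigma>\<^sub>1 * \<delta> * \<tau>\<^sub>v" unfolding dV by (simp add: mult_ac)

  \<comment> \<open>The \<open>r\<close> orthonormal columns give \<open>\<parallel>V\<^sub>r\<parallel>\<^sub>F = sqrt r \<le> sqrt (min n K)\<close>; this is where the factor
    \<open>sqrt (min n K)\<close> of \<open>\<beta>\<^sub>1\<close> comes from.\<close>
  have R_le: "frobenius_norm R \<le> sqrt ?N * (\<sigma>\<^sub>1 * \<delta>)"
  proof -
    have "frobenius_norm R \<le> sqrt (real r) * (\<sigma>\<^sub>1 * \<delta>)"
      unfolding R_def Xdot \<delta>_def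
      using frobenius_norm_projected_rhs [OF Vr X \<Delta> \<sigma>] frobenius_norm_orthonormal [OF Vr orth(1)] by simp
    also have "\<dots> \<le> sqrt ?N * (\<sigma>\<^sub>1 * \<delta>)"
      using rN \<sigma>0 \<delta>0 by (intro mult_right_mono) auto
    finally show ?thesis .
  qed

  let ?g = "sqrt_\<gamma>_min"
  have g: "0 < ?g" and g_le: "\<And>j. j < d \<Longrightarrow> ?g \<le> sqrt (\<gamma> j)"
  proof -
    have "(\<lambda>j. sqrt (\<gamma> j)) ` {..<d} \<noteq> {}" using d by auto
    then show "0 < ?g"
      using \<open>\<And>j. j < d \<Longrightarrow> \<gamma> j > 0\<close> unfolding \<open>sqrt_\<gamma>_min = _\<close> by (subst Min_gr_iff) auto
    show "?g \<le> sqrt (\<gamma> j)" if "j < d" for j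
      using that unfolding \<open>sqrt_\<gamma>_min = _\<close> by (intro Min_le) auto
  qed
  have bound: "?g * euclid_norm x \<le> euclid_norm (G *\<^sub>v x)" if "x \<in> carrier_vec d" for x
    unfolding G_eq using g g_le that by (intro euclid_norm_mat_diag_ge) auto
  have O: "Obatch = pseudoinverse (D @\<^sub>r G) * (R @\<^sub>r 0\<^sub>m d r)"
    and O': "Ostream = pseudoinverse (D' @\<^sub>r G) * (R' @\<^sub>r 0\<^sub>m d r)"
    unfolding \<open>Obatch = _\<close> \<open>Ostream = _\<close> Dbar Dt Rbar Rt by simp_all
  have dims: "dim_row Obatch = dim_row Ostream" "dim_col Obatch = dim_col Ostream"
  proof -
    have pinv: "pseudoinverse (H @\<^sub>r G) \<in> carrier_mat d (K + d)" if "H \<in> carrier_mat K d" for H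
      by (rule pseudoinverse_append_rows_carrier [OF that G g bound])
    from carrier_matD [OF pinv [OF D]] carrier_matD [OF pinv [OF D']]
    show "dim_row Obatch = dim_row Ostream" "dim_col Obatch = dim_col Ostream"
      using R R' unfolding O O' by (simp_all add: append_rows_def)
  qed
  have "frobenius_norm (Obatch - Ostream) = frobenius_norm (Ostream - Obatch)"
    using dims by (intro frobenius_norm_minus_commute carrier_matI) auto
  also have "\<dots> \<le> 1 / ?g * frobenius_norm E\<^sub>R + spectral_norm E\<^sub>D / ?g\<^sup>2 * frobenius_norm R"
    unfolding E\<^sub>R E\<^sub>D by (rule frobenius_norm_pseudoinverse_perturbation [OF D D' G g bound R R' O O'])
  also have "\<dots> \<le> 1 / ?g * (\<sigma>\<^sub>1 * \<delta> * \<tau>\<^sub>v) + (\<kappa> * \<tau>\<^sub>v) / ?g\<^sup>2 * (sqrt ?N * (\<sigma>\<^sub>1 * \<delta>))"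
    using g E\<^sub>R_le E\<^sub>D_le R_le \<kappa>0 \<tau>0
    by (intro add_mono mult_mono divide_right_mono) auto
  also have "\<dots> = \<sigma>\<^sub>1 * \<delta> / ?g * \<tau>\<^sub>v * (1 + 1 * \<beta>\<^sub>1 / ?g)"
    using g unfolding \<beta> by (simp add: field_simps power2_eq_square)
  also have "\<dots> \<le> \<sigma>\<^sub>1 * \<delta> / ?g * \<tau>\<^sub>v * (1 + \<alpha> * \<beta>\<^sub>1 / ?g)"
  proof -
    have "1 \<le> \<alpha>" unfolding \<open>\<alpha> = _\<close> by simp
    then show ?thesis
      using g \<sigma>0 \<delta>0 \<tau>0 \<kappa>0 unfolding \<beta>
      by (intro mult_left_mono add_left_mono divide_right_mono mult_right_mono) auto
  qed
  finally have "frobenius_norm (Obatch - Ostream) \<le> \<sigma>\<^sub>1 * \<delta> / ?g * \<tau>\<^sub>v * (1 + \<alpha> * \<beta>\<^sub>1 / ?g)" .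
  moreover have "\<beta>\<^sub>1 / sqrt ?N = \<kappa>" unfolding \<beta> using N by simp
  ultimately show ?thesis using E\<^sub>D_le E\<^sub>R_le unfolding \<delta>_def by simp
qed

end
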